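(* Let $\mathbb{M}$ be the set of all matroids (up to isomorphism) of rank at least three of the form $[AG(r-1,2)+e]\backslash X$, where $X\subseteq E(AG(r-1,2))$ is such that $AG(r-1,2)\backslash X$ is hyperplane-complementary of rank $r$. A binary matroid $M$ is an excluded series minor for the class of circuit-difference matroids if and only if $M^*\in\mathbb{M}$.
   Context: All matroids are finite. A matroid $M$ is circuit-difference if the symmetric difference $C_1\triangle C_2$ is a circuit of $M$ whenever $C_1$ and $C_2$ are distinct circuits of $M$ with $C_1\cap C_2\neq\emptyset$. A series contraction of a matroid is the contraction of an element $e$ for which there is an element $f\neq e$ such that $\{e,f\}$ is a cocircuit. A series minor of $M$ is a matroid obtained from $M$ by a (possibly empty) sequence of single-element deletions and series contractions. An excluded series minor for a class of matroids is a matroid that is not in the class but all of whose proper series minors are in the class. A matroid is hyperplane-complementary if the complement (in the ground set) of every hyperplane is a hyperplane. $AG(r-1,2)$ is the rank-$r$ binary affine geometry, obtained from the binary projective geometry $PG(r-1,2)$ by deleting all the elements of a hyperplane. $AG(r-1,2)+e$ denotes the unique (up to isomorphism) simple binary rank-$r$ single-element extension of $AG(r-1,2)$, where $e$ is the added element; equivalently, it is obtained from $PG(r-1,2)$ by deleting all elements of a hyperplane except for one element $e$ of that hyperplane. *)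

theory Defs
  imports Complex_Main "HOL-Library.Z2" "HOL-Library.Function_Algebras"
begin

section \<open>Finite matroids\<close>

record 'a matroid =
  ground :: "'a set"
  indep :: "'a set set"

locale matroid =
  fixes M :: "'a matroid"
  assumes finite_ground: "finite (ground M)"
    and indep_subset_ground: "I \<in> indep M \<Longrightarrow> I \<subseteq> ground M"
    and empty_indep: "{} \<in> indep M"
    and indep_subset: "I \<in> indep M \<Longrightarrow> J \<subseteq> I \<Longrightarrow> J \<in> indep M"
    and indep_augment: "I \<in> indep M \<Longrightarrow> J \<in> indep M \<Longrightarrow> card I < card J \<Longrightarrow>
      \<exists>x\<in>J - I. insert x I \<in> indep M"

definition basis :: "'a matroid \<Rightarrow> 'a set \<Rightarrow> bool" where
  "basis M B \<longleftrightarrow> B \<in> indep M \<and> (\<forall>I\<in>indep M. B \<subseteq> I \<longrightarrow> I = B)"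

definition circuit :: "'a matroid \<Rightarrow> 'a set \<Rightarrow> bool" where
  "circuit M C \<longleftrightarrow> C \<subseteq> ground M \<and> C \<notin> indep M \<and> (\<forall>D. D \<subset> C \<longrightarrow> D \<in> indep M)"

definition rank :: "'a matroid \<Rightarrow> 'a set \<Rightarrow> nat" where
  "rank M X = Max (card ` {I \<in> indep M. I \<subseteq> X})"

definition closure :: "'a matroid \<Rightarrow> 'a set \<Rightarrow> 'a set" where
  "closure M X = {x \<in> ground M. rank M (insert x X) = rank M X}"

definition flat :: "'a matroid \<Rightarrow> 'a set \<Rightarrow> bool" where
  "flat M F \<longleftrightarrow> F \<subseteq> ground M \<and> closure M F = F"

(* A flat of rank r(M) - 1; stated with Suc so that a rank-0 matroid has no hyperplanes. *)
definition hyperplane :: "'a matroid \<Rightarrow> 'a set \<Rightarrow> bool" where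
  "hyperplane M H \<longleftrightarrow> flat M H \<and> Suc (rank M H) = rank M (ground M)"

definition dual :: "'a matroid \<Rightarrow> 'a matroid" where
  "dual M = \<lparr>ground = ground M, indep = {I. \<exists>B. basis M B \<and> I \<subseteq> ground M - B}\<rparr>"

definition cocircuit :: "'a matroid \<Rightarrow> 'a set \<Rightarrow> bool" where
  "cocircuit M C \<longleftrightarrow> circuit (dual M) C"

definition delete :: "'a matroid \<Rightarrow> 'a set \<Rightarrow> 'a matroid" where
  "delete M X = \<lparr>ground = ground M - X, indep = {I \<in> indep M. I \<inter> X = {}}\<rparr>"

definition contract :: "'a matroid \<Rightarrow> 'a set \<Rightarrow> 'a matroid" where
  "contract M X = dual (delete (dual M) X)"

definition isomorphic :: "'a matroid \<Rightarrow> 'b matroid \<Rightarrow> bool" where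
  "isomorphic M N \<longleftrightarrow> (\<exists>f. bij_betw f (ground M) (ground N) \<and>
     (\<forall>I. I \<subseteq> ground M \<longrightarrow> (I \<in> indep M \<longleftrightarrow> f ` I \<in> indep N)))"

section \<open>Circuit-difference and hyperplane-complementary matroids\<close>

definition circuit_difference :: "'a matroid \<Rightarrow> bool" where
  "circuit_difference M \<longleftrightarrow> (\<forall>C\<^sub>1 C\<^sub>2. circuit M C\<^sub>1 \<longrightarrow> circuit M C\<^sub>2 \<longrightarrow> C\<^sub>1 \<noteq> C\<^sub>2 \<longrightarrow>
     C\<^sub>1 \<inter> C\<^sub>2 \<noteq> {} \<longrightarrow> circuit M (sym_diff C\<^sub>1 C\<^sub>2))"

definition hyperplane_complementary :: "'a matroid \<Rightarrow> bool" where
  "hyperplane_complementary M \<longleftrightarrow> (\<forall>H. hyperplane M H \<longrightarrow> hyperplane M (ground M - H))"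

section \<open>Series minors\<close>

definition series_minor_step :: "'a matroid \<Rightarrow> 'a matroid \<Rightarrow> bool" where
  "series_minor_step M N \<longleftrightarrow>
     (\<exists>e\<in>ground M. N = delete M {e}) \<or>
     (\<exists>e f. f \<noteq> e \<and> cocircuit M {e, f} \<and> N = contract M {e})"

definition series_minor :: "'a matroid \<Rightarrow> 'a matroid \<Rightarrow> bool" where
  "series_minor N M \<longleftrightarrow> series_minor_step\<^sup>*\<^sup>* M N"

definition excluded_series_minor :: "('a matroid \<Rightarrow> bool) \<Rightarrow> 'a matroid \<Rightarrow> bool" where
  "excluded_series_minor P M \<longleftrightarrow> matroid M \<and> \<not> P M \<and>
     (\<forall>N. series_minor N M \<longrightarrow> N \<noteq> M \<longrightarrow> P N)"

section \<open>Binary matroids and binary geometries\<close>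

definition gf2_scale :: "bit \<Rightarrow> (nat \<Rightarrow> bit) \<Rightarrow> nat \<Rightarrow> bit" where
  "gf2_scale c v = (\<lambda>i. c * v i)"

global_interpretation gf2: vector_space gf2_scale
  by standard
    (simp_all only: gf2_scale_def fun_eq_iff plus_fun_apply
      distrib_left distrib_right mult.assoc mult_1,
      simp_all)

(* The n-dimensional space over GF(2), as the sequences supported on the first n coordinates. *)
definition gf2_space :: "nat \<Rightarrow> (nat \<Rightarrow> bit) set" where
  "gf2_space n = {v. \<forall>i\<ge>n. v i = 0}"

(* The matroid of a family of vectors indexed by E. The vectors may be zero or repeat,
   hence the injectivity condition. *)
definition vector_matroid :: "'a set \<Rightarrow> ('a \<Rightarrow> nat \<Rightarrow> bit) \<Rightarrow> 'a matroid" where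
  "vector_matroid E \<phi> =
     \<lparr>ground = E, indep = {I. I \<subseteq> E \<and> inj_on \<phi> I \<and> gf2.independent (\<phi> ` I)}\<rparr>"

(* \<phi> lists the columns of a binary matrix with m rows that represents M. *)
definition binary :: "'a matroid \<Rightarrow> bool" where
  "binary M \<longleftrightarrow> (\<exists>m \<phi>. \<phi> ` ground M \<subseteq> gf2_space m \<and> M = vector_matroid (ground M) \<phi>)"

(* PG r is the geometry of rank r, usually written PG(r - 1, 2); its elements are the nonzero
   vectors, since over GF(2) every one-dimensional subspace has exactly one. *)
definition PG :: "nat \<Rightarrow> (nat \<Rightarrow> bit) matroid" where
  "PG r = vector_matroid (gf2_space r - {0}) (\<lambda>v. v)"

(* For a hyperplane H of PG r, this is AG(r - 1, 2); up to isomorphism it does not depend on H. *)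
definition AG :: "nat \<Rightarrow> (nat \<Rightarrow> bit) set \<Rightarrow> (nat \<Rightarrow> bit) matroid" where
  "AG r H = delete (PG r) H"

(* For a hyperplane H of PG r and e in H, this is AG(r - 1, 2) + e; up to isomorphism it depends
   on neither H nor e. *)
definition AG_plus :: "nat \<Rightarrow> (nat \<Rightarrow> bit) set \<Rightarrow> (nat \<Rightarrow> bit) \<Rightarrow> (nat \<Rightarrow> bit) matroid" where
  "AG_plus r H e = delete (PG r) (H - {e})"

(* Contains every isomorphic copy inside some PG r; membership up to isomorphism is expressed
   with the predicate isomorphic. *)
definition AG_plus_family :: "(nat \<Rightarrow> bit) matroid set" where
  "AG_plus_family = {N. \<exists>r H e X. hyperplane (PG r) H \<and> e \<in> H \<and>
     X \<subseteq> ground (AG r H) \<and>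
     hyperplane_complementary (delete (AG r H) X) \<and>
     rank (delete (AG r H) X) (ground (delete (AG r H) X)) = r \<and>
     N = delete (AG_plus r H e) X \<and>
     rank N (ground N) \<ge> 3}"

end

theory Submission
  imports Defs
begin

text \<open>The circuits of a binary matroid \<open>M\<close> are the minimal nonempty members of its cycle space \<open>\<C>\<close>, a
  family closed under symmetric difference; it is the row space of any matrix representing the dual
  of \<open>M\<close>, and the hyperplanes of the dual are the complements of these circuits. The excluded series
  minors have no series pairs, so that their duals are simple, and single-element deletions
  suffice for the remaining minimality.

  If \<open>C\<^sub>1\<close>, \<open>C\<^sub>2\<close> are intersecting circuits of an excluded series minor whose symmetric difference is
  not a circuit, minimality under deletion makes every such pair cover the ground set \<open>E\<close>. Hence
  their symmetric difference is a union of exactly two disjoint circuits, and \<open>C\<^sub>1 \<inter> C\<^sub>2\<close> is a single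
  element \<open>e\<close>. So \<open>E - {e}\<close> is a cycle, which places the dual without \<open>e\<close> in an affine geometry, and
  the circuits of \<open>M / e\<close> turn out to be closed under complementation in \<open>E - {e}\<close>, which is
  hyperplane-complementarity of the dual without \<open>e\<close>. Conversely, complementarity forces every
  nonempty cycle other than \<open>E - {e}\<close> to be a circuit. The only violating pairs are then a cycle \<open>C\<close> and
  its symmetric difference with \<open>E - {e}\<close>, where \<open>e \<in> C\<close>, and every deletion destroys them.\<close>

section \<open>Critical pairs of circuits\<close>

definition min_member :: "'a set set \<Rightarrow> 'a set \<Rightarrow> bool" where
  "min_member \<C> C \<longleftrightarrow> C \<in> \<C> \<and> C \<noteq> {} \<and> (\<forall>D\<in>\<C>. D \<subseteq> C \<longrightarrow> D = {} \<or> D = C)"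

lemma min_member_mem: "min_member \<C> C \<Longrightarrow> C \<in> \<C>"
  and min_member_nonempty: "min_member \<C> C \<Longrightarrow> C \<noteq> {}"
  unfolding min_member_def by blast+

lemma min_memberD: "min_member \<C> C \<Longrightarrow> D \<in> \<C> \<Longrightarrow> D \<subseteq> C \<Longrightarrow> D \<noteq> {} \<Longrightarrow> D = C"
  unfolding min_member_def by blast

text \<open>A linear subspace over GF(2) of the power set of \<open>E\<close>, with symmetric
  difference as addition. For a binary matroid the minimal nonempty members of its cycle space are
  its circuits.\<close>

locale cycle_space =
  fixes E :: "'a set" and \<C> :: "'a set set"
  assumes finite_E: "finite E"
    and sub_E: "C \<in> \<C> \<Longrightarrow> C \<subseteq> E"
    and empty_mem: "{} \<in> \<C>"
    and sym_diff_mem: "C \<in> \<C> \<Longrightarrow> D \<in> \<C> \<Longrightarrow> sym_diff C D \<in> \<C>"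
begin

lemma min_member_sub: "min_member \<C> C \<Longrightarrow> C \<subseteq> E"
  using min_member_mem sub_E by blast

text \<open>It suffices to take \<open>D\<close> minimal among the members through \<open>x\<close>:
  a member \<open>D'\<close> inside \<open>D\<close> that misses \<open>x\<close> leaves the member
  \<open>D - D'\<close> through \<open>x\<close>, and minimality then makes \<open>D'\<close>
  empty.\<close>

lemma min_member_through:
  assumes "C \<in> \<C>" "x \<in> C"
  obtains D where "min_member \<C> D" "x \<in> D" "D \<subseteq> C"
proof -
  let ?A = "{D\<in>\<C>. x \<in> D \<and> D \<subseteq> C}"
  have "finite ?A"
    using finite_E sub_E by (auto intro: finite_subset[of _ "Pow E"])
  moreover have "C \<in> ?A" using assms by auto
  ultimately obtain D where D: "D \<in> ?A" and min': "\<forall>D'\<in>?A. D' \<subseteq> D \<longrightarrow> D = D'"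
    by (rule finite_has_minimal2[THEN bexE]) blast
  have min: "D = D'" if "D' \<in> \<C>" "x \<in> D'" "D' \<subseteq> C" "D' \<subseteq> D" for D'
    using that min' by simp
  have DC: "D \<in> \<C>" "x \<in> D" "D \<subseteq> C" using D by simp_all
  have "D' = {} \<or> D' = D" if D': "D' \<in> \<C>" "D' \<subseteq> D" for D'
  proof (cases "x \<in> D'")
    case True
    then have "D = D'" using min[of D'] DC D' by blast
    then show ?thesis by simp
  next
    case False
    have "sym_diff D D' = D - D'" using D' by blast
    then have "D - D' \<in> \<C>" using sym_diff_mem[OF DC(1) D'(1)] by simp
    then have "D = D - D'" using min[of "D - D'"] DC False by blast
    then show ?thesis using D' by blast
  qed
  then have "min_member \<C> D" using DC unfolding min_member_def by blast
  then show thesis using that DC by blast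
qed

end

text \<open>\<open>min_sym_diff\<close> says that deleting any one element gives a
  circuit-difference matroid. \<open>separating\<close> says that no two elements lie in exactly the
  same cycles, which excludes series pairs. The pair \<open>C1\<close>, \<open>C2\<close> witnesses
  the failure in the matroid itself.\<close>

locale critical_space = cycle_space +
  fixes C1 C2
  assumes C1: "min_member \<C> C1" and C2: "min_member \<C> C2"
    and C1_C2: "C1 \<noteq> C2" "C1 \<inter> C2 \<noteq> {}"
    and not_min: "\<not> min_member \<C> (sym_diff C1 C2)"
    and min_sym_diff: "\<And>C D x. min_member \<C> C \<Longrightarrow> min_member \<C> D \<Longrightarrow> C \<noteq> D \<Longrightarrow>
      C \<inter> D \<noteq> {} \<Longrightarrow> x \<in> E \<Longrightarrow> x \<notin> C \<Longrightarrow> x \<notin> D \<Longrightarrow> min_member \<C> (sym_diff C D)"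
    and separating: "\<And>x y. x \<in> E \<Longrightarrow> y \<in> E \<Longrightarrow> x \<noteq> y \<Longrightarrow> \<exists>C\<in>\<C>. x \<in> C \<longleftrightarrow> y \<notin> C"
begin

lemma cover: "C1 \<union> C2 = E"
  using min_member_sub[OF C1] min_member_sub[OF C2] min_sym_diff[OF C1 C2 C1_C2] not_min by blast

lemma not_subset_min: "min_member \<C> C \<Longrightarrow> min_member \<C> D \<Longrightarrow> C \<subseteq> D \<Longrightarrow> C = D"
  unfolding min_member_def by blast

text \<open>Circuits are split off \<open>sym_diff C1 C2\<close> one after the other. A third one
  would leave an uncovered element for each of three uses of \<open>min_sym_diff\<close>, which
  together would make the union of the first two a circuit.\<close>

lemma ex_decomposition:
  obtains D1 D2 where "min_member \<C> D1" "min_member \<C> D2" "D1 \<inter> D2 = {}"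
    "D1 \<union> D2 = sym_diff C1 C2"
proof -
  let ?F = "sym_diff C1 C2"
  have F: "?F \<in> \<C>" "?F \<noteq> {}"
    using sym_diff_mem[OF min_member_mem[OF C1] min_member_mem[OF C2]] C1_C2 by blast+
  then obtain D1 where D1: "min_member \<C> D1" "D1 \<subseteq> ?F"
    using min_member_through by blast
  then have D1F: "D1 \<noteq> ?F" using not_min by metis
  have F1: "?F - D1 \<in> \<C>" "?F - D1 \<noteq> {}"
  proof -
    have "sym_diff ?F D1 \<in> \<C>" using sym_diff_mem[OF F(1) min_member_mem[OF D1(1)]] .
    moreover have "sym_diff ?F D1 = ?F - D1" using D1 by blast
    ultimately show "?F - D1 \<in> \<C>" by metis
    show "?F - D1 \<noteq> {}" using D1F D1 by blast
  qed
  then obtain D2 where D2: "min_member \<C> D2" "D2 \<subseteq> ?F - D1"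
    using min_member_through by blast
  \<comment> \<open>Such a circuit avoids \<open>C1 \<inter> C2\<close>, so it differs from
    \<open>C1\<close> and \<open>C2\<close> and cannot lie inside either of them.\<close>
  have meets: "D \<inter> C1 \<noteq> {} \<and> D - C1 \<noteq> {}" if D: "min_member \<C> D" "D \<subseteq> ?F" for D
    using D(2) C1_C2 min_member_nonempty[OF D(1)] not_subset_min[OF D(1) C1]
      not_subset_min[OF D(1) C2] by blast
  have "D1 \<union> D2 = ?F"
  proof (rule ccontr)
    assume neq: "D1 \<union> D2 \<noteq> ?F"
    have "sym_diff (?F - D1) D2 \<in> \<C>" using sym_diff_mem[OF F1(1) min_member_mem[OF D2(1)]] .
    moreover have "sym_diff (?F - D1) D2 = ?F - D1 - D2" using D2 by blast
    ultimately have "?F - D1 - D2 \<in> \<C>" by metis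
    moreover have "?F - D1 - D2 \<noteq> {}" using neq D1 D2 by blast
    ultimately obtain D3 where D3: "min_member \<C> D3" "D3 \<subseteq> ?F - D1 - D2"
      using min_member_through by blast
    have m: "D1 \<inter> C1 \<noteq> {}" "D1 - C1 \<noteq> {}" "D2 \<inter> C1 \<noteq> {}" "D2 - C1 \<noteq> {}" "D3 - C1 \<noteq> {}"
      using meets[of D1] meets[of D2] meets[of D3] D1 D2 D3 by blast+
    obtain p where p: "p \<in> C1" "p \<in> C2" using C1_C2 by blast
    \<comment> \<open>The uncovered elements are \<open>x2\<close> for the first sum,
      \<open>x1\<close> for the second (it cancels in \<open>sym_diff C1 D1\<close>) and
      \<open>x3\<close> for the third. The element \<open>p\<close> lies in no \<open>D1\<close> or
      \<open>D2\<close> and is common to the last two circuits.\<close>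
    obtain x1 x2 x3 where x: "x1 \<in> D1 \<inter> C1" "x2 \<in> D2 - C1" "x3 \<in> D3 - C1" using m by blast
    have xE: "x1 \<in> E" "x2 \<in> E" "x3 \<in> E" using x min_member_sub[OF D1(1)] min_member_sub[OF D2(1)] min_member_sub[OF D3(1)] by blast+
    have s1: "min_member \<C> (sym_diff C1 D1)"
      using C1 D1(1) by (rule min_sym_diff[where x = x2]) (use D1 D2 m p x xE in blast)+
    have s2: "min_member \<C> (sym_diff (sym_diff C1 D1) D2)"
      using s1 D2(1) by (rule min_sym_diff[where x = x1]) (use D1 D2 m p x xE in blast)+
    have "min_member \<C> (sym_diff C1 (sym_diff (sym_diff C1 D1) D2))"
      using C1 s2 by (rule min_sym_diff[where x = x3]) (use D1 D2 D3 m p x xE in blast)+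
    moreover have "sym_diff C1 (sym_diff (sym_diff C1 D1) D2) = D1 \<union> D2" using D2 by blast
    ultimately have "min_member \<C> (D1 \<union> D2)" by metis
    then have "D1 = D1 \<union> D2" using D1 not_subset_min[of D1 "D1 \<union> D2"] by blast
    then show False using D2 m by blast
  qed
  then show thesis using that D1 D2 by blast
qed

text \<open>All elements of \<open>C1 \<inter> C2\<close> lie in one series class: a circuit separating two of them would
  form, with two of the four circuits inside \<open>C1 \<union> C2\<close> through \<open>C1 \<inter> C2\<close>, a pair of circuits
  whose symmetric difference is again \<open>sym_diff C1 C2\<close> but which does not cover \<open>E\<close>.\<close>

lemma inter_subsingleton:
  assumes e: "e \<in> C1 \<inter> C2" and f: "f \<in> C1 \<inter> C2"
  shows "e = f"
proof (rule ccontr)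
  assume "e \<noteq> f"
  obtain D1 D2 where D: "min_member \<C> D1" "min_member \<C> D2" "D1 \<inter> D2 = {}"
    "D1 \<union> D2 = sym_diff C1 C2"
    by (rule ex_decomposition)
  have ne: "D1 \<noteq> {}" "D2 \<noteq> {}" using D min_member_nonempty by blast+
  have no_separation: False if e: "e \<in> C1 \<inter> C2" and f: "f \<in> C1 \<inter> C2" and C: "C \<in> \<C>" "e \<in> C" "f \<notin> C" for e f C
  proof -
    obtain K where K: "min_member \<C> K" "e \<in> K" "f \<notin> K"
      using min_member_through[OF C(1,2)] C(3) by blast
    have ef: "e \<in> E" "f \<in> E" using e f min_member_sub[OF C1] by blast+
    \<comment> \<open>If \<open>K\<close> covers \<open>E\<close> with neither \<open>A\<close> nor
      \<open>B\<close>, then \<open>sym_diff K A\<close> and \<open>sym_diff K B\<close> are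
      circuits. Both miss \<open>e\<close> and share \<open>f\<close>, so their symmetric
      difference, which is that of \<open>A\<close> and \<open>B\<close>, would be a
      circuit.\<close>
    have pair: "K \<union> A = E \<or> K \<union> B = E"
      if AB: "min_member \<C> A" "min_member \<C> B" "e \<in> A" "f \<in> A" "e \<in> B" "f \<in> B"
        "sym_diff A B = sym_diff C1 C2" for A B
    proof (rule ccontr)
      assume neg: "\<not> ?thesis"
      have KE: "K \<subseteq> E" "A \<subseteq> E" "B \<subseteq> E" using min_member_sub K AB by blast+
      obtain x y where xy: "x \<in> E" "x \<notin> K" "x \<notin> A" "y \<in> E" "y \<notin> K" "y \<notin> B"
        using neg KE by blast
      have KA: "min_member \<C> (sym_diff K A)"
        using K(1) AB(1) by (rule min_sym_diff[where x = x]) (use K AB xy in blast)+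
      have KB: "min_member \<C> (sym_diff K B)"
        using K(1) AB(2) by (rule min_sym_diff[where x = y]) (use K AB xy in blast)+
      have eq: "sym_diff (sym_diff K A) (sym_diff K B) = sym_diff A B" by blast
      have AneB: "A \<noteq> B" using AB(7) C1_C2 by blast
      have "min_member \<C> (sym_diff (sym_diff K A) (sym_diff K B))"
        using KA KB by (rule min_sym_diff[where x = e]) (use K AB ef AneB in blast)+
      then show False using eq AB(7) not_min by metis
    qed
    have Di: "D1 \<subseteq> E" "D2 \<subseteq> E" using D min_member_sub by blast+
    have mD: "D1 \<inter> C1 \<noteq> {}" "D1 - C1 \<noteq> {}" "D2 \<inter> C1 \<noteq> {}" "D2 - C1 \<noteq> {}"
      using D(4) C1_C2 not_subset_min[OF D(1) C1] not_subset_min[OF D(1) C2]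
        not_subset_min[OF D(2) C1] not_subset_min[OF D(2) C2] ne e by blast+
    have Q1: "min_member \<C> (sym_diff C1 D1)"
    proof -
      obtain x where "x \<in> D2 - C1" using mD by blast
      then show ?thesis
        using C1 D(1) by (intro min_sym_diff[where x = x]) (use D mD Di in blast)+
    qed
    have Q2: "min_member \<C> (sym_diff C1 D2)"
    proof -
      obtain x where "x \<in> D1 - C1" using mD by blast
      then show ?thesis
        using C1 D(2) by (intro min_sym_diff[where x = x]) (use D mD Di in blast)+
    qed
    have efD: "e \<notin> D1" "e \<notin> D2" "f \<notin> D1" "f \<notin> D2" using D(4) e f by blast+
    have "K \<union> C1 = E \<or> K \<union> C2 = E"
      using pair[OF C1 C2] e f by blast
    moreover have "K \<union> sym_diff C1 D1 = E \<or> K \<union> sym_diff C1 D2 = E"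
    proof (rule pair[OF Q1 Q2])
      show "sym_diff (sym_diff C1 D1) (sym_diff C1 D2) = sym_diff C1 C2"
        using D(3,4) by blast
    qed (use e f efD in blast)+
    moreover have "C2 = sym_diff (sym_diff C1 D1) D2" using D(3,4) by blast
    \<comment> \<open>Within \<open>D1 \<union> D2\<close>, the set missed by \<open>C1\<close> or
      \<open>C2\<close> is the part outside or inside \<open>C1\<close>. The sets missed by the
      other two circuits combine the part of one of \<open>D1\<close>, \<open>D2\<close> inside
      \<open>C1\<close> with the part of the other outside \<open>C1\<close>. One set of each kind
      always fills \<open>D1\<close> or \<open>D2\<close>.\<close>
    ultimately have "D1 \<subseteq> K \<or> D2 \<subseteq> K"
      using Di D(3) by blast
    then show False
      using not_subset_min[OF D(1) K(1)] not_subset_min[OF D(2) K(1)] K(2) efD by blast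
  qed
  obtain C where C: "C \<in> \<C>" "e \<in> C \<longleftrightarrow> f \<notin> C"
    using separating[of e f] e f \<open>e \<noteq> f\<close> min_member_sub[OF C1] by blast
  then show False using no_separation[OF e f C(1)] no_separation[OF f e C(1)] by blast
qed

section \<open>The common element of the critical pair and complementation in the rest of the ground
  set\<close>

definition tip :: 'a where "tip = (SOME e. e \<in> C1 \<inter> C2)"

lemma inter_eq: "C1 \<inter> C2 = {tip}"
proof -
  have "tip \<in> C1 \<inter> C2" unfolding tip_def using C1_C2 someI_ex[of "\<lambda>e. e \<in> C1 \<inter> C2"] by blast
  then show ?thesis using inter_subsingleton by blast
qed

lemma tip_in_E: "tip \<in> E"
  using inter_eq cover by blast

lemma sym_diff_eq: "sym_diff C1 C2 = E - {tip}"
  using inter_eq cover by blast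

lemma complement_tip_mem: "E - {tip} \<in> \<C>"
  using sym_diff_mem[OF min_member_mem[OF C1] min_member_mem[OF C2]] sym_diff_eq by metis

lemma tip_not_mem: "{tip} \<notin> \<C>"
proof
  assume a: "{tip} \<in> \<C>"
  have "{tip} = C1" "{tip} = C2"
    using a inter_eq min_memberD[OF C1 a] min_memberD[OF C2 a] by blast+
  then show False using C1_C2 by blast
qed

text \<open>If \<open>C\<close> avoided \<open>D1\<close>, then so would \<open>sym_diff C D2\<close>; applying \<open>step\<close> to
  both makes \<open>C - {tip}\<close> one of the two parts into which \<open>C1\<close> splits \<open>D2\<close>, and then \<open>C\<close> is properly
  contained in the circuit \<open>C1\<close> or in the circuit \<open>sym_diff C1 D2\<close>.\<close>

lemma meets_part:
  assumes D: "min_member \<C> D1" "min_member \<C> D2" "D1 \<inter> D2 = {}" "D1 \<union> D2 = E - {tip}"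
    and C: "min_member \<C> C" "tip \<in> C"
  shows "C \<inter> D1 \<noteq> {}"
proof
  assume CD1: "C \<inter> D1 = {}"
  have subs: "D1 \<subseteq> E" "D2 \<subseteq> E" "C \<subseteq> E" using D C min_member_sub by blast+
  have ne: "D1 \<noteq> {}" "D2 \<noteq> {}" using D min_member_nonempty by blast+
  have tipD: "tip \<notin> D1" "tip \<notin> D2" using D(4) by blast+
  have tipC: "tip \<in> C1" "tip \<in> C2" using inter_eq by blast+
  have nD: "\<not> D1 \<subseteq> C1" "\<not> D2 \<subseteq> C1" "\<not> D1 \<subseteq> C2" "\<not> D2 \<subseteq> C2"
    using not_subset_min[OF D(1) C1] not_subset_min[OF D(2) C1] not_subset_min[OF D(1) C2]
      not_subset_min[OF D(2) C2] tipC tipD by blast+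
  have split: "C1 \<inter> D1 \<noteq> {}" "C1 \<inter> D2 \<noteq> {}"
    using nD sym_diff_eq D(4) by blast+
  obtain z where z: "z \<in> D1" "z \<notin> C1" "z \<in> E" using nD subs by blast
  \<comment> \<open>If \<open>C\<close> missed \<open>x\<close> in \<open>D2 \<inter> C1\<close> and
    \<open>y\<close> in \<open>D2 - C1\<close>, then adding \<open>C1\<close> to \<open>C\<close>
    and to \<open>D1\<close> would give two circuits that share \<open>x\<close> and miss
    \<open>y\<close>. Their symmetric difference \<open>C \<union> D1\<close> would be a circuit
    properly containing \<open>C\<close>.\<close>
  have step: "D2 \<inter> C1 \<subseteq> C \<or> D2 - C1 \<subseteq> C"
    if C: "min_member \<C> C" "tip \<in> C" "C \<inter> D1 = {}" for C
  proof (rule ccontr)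
    assume "\<not> ?thesis"
    then obtain x y where x: "x \<in> D2" "x \<in> C1" "x \<notin> C" and y: "y \<in> D2" "y \<notin> C1" "y \<notin> C"
      by blast
    have xy: "x \<notin> D1" "y \<notin> D1" "y \<in> E" using x y D(3) subs by blast+
    have zC: "z \<notin> C" using z C by blast
    have QC: "min_member \<C> (sym_diff C1 C)"
      using C1 C(1) by (rule min_sym_diff[where x = z]) (use C tipC x z zC in blast)+
    have QD: "min_member \<C> (sym_diff C1 D1)"
      using C1 D(1) by (rule min_sym_diff[where x = y]) (use tipC tipD split xy y in blast)+
    have "min_member \<C> (sym_diff (sym_diff C1 C) (sym_diff C1 D1))"
      using QC QD by (rule min_sym_diff[where x = y]) (use C tipC tipD x y xy in blast)+
    moreover have "sym_diff (sym_diff C1 C) (sym_diff C1 D1) = C \<union> D1" using C(3) by blast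
    ultimately have "min_member \<C> (C \<union> D1)" by metis
    then have "C = C \<union> D1" using not_subset_min[OF C(1)] by blast
    then show False using C(3) ne by blast
  qed
  have Q2: "min_member \<C> (sym_diff C1 D2)"
    using C1 D(2) by (rule min_sym_diff[where x = z]) (use D(3) tipC tipD split z in blast)+
  have "C \<noteq> {tip}" using min_member_mem[OF C(1)] tip_not_mem by blast
  moreover have sub: "C - {tip} \<subseteq> D2" using CD1 D(4) subs by blast
  ultimately have CD2: "C \<inter> D2 \<noteq> {}" using C(2) by blast
  have "min_member \<C> (sym_diff C D2)"
    using C(1) D(2) by (rule min_sym_diff[where x = z]) (use D(3) CD1 C CD2 tipD z in blast)+
  then have "D2 \<inter> C1 \<subseteq> sym_diff C D2 \<or> D2 - C1 \<subseteq> sym_diff C D2"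
    by (rule step) (use CD1 C tipD D(3) in blast)+
  moreover have "D2 \<inter> C1 \<subseteq> C \<or> D2 - C1 \<subseteq> C" using step[OF C CD1] .
  ultimately have "C \<inter> D2 = D2 \<inter> C1 \<or> C \<inter> D2 = D2 - C1"
    using split(2) nD(2) by blast
  then have "C \<subseteq> C1 \<or> C \<subseteq> sym_diff C1 D2" using sub tipC tipD by blast
  then have "C = C1 \<or> C = sym_diff C1 D2"
    using not_subset_min[OF C(1) C1] not_subset_min[OF C(1) Q2] by blast
  then show False using CD1 split(1) D(3) by blast
qed

text \<open>The set \<open>E - {tip}\<close> is added in two portions \<open>D1\<close> and
  \<open>D2\<close>. By \<open>meets_part\<close> both meet \<open>C\<close>; an element of
  \<open>D2 - C\<close> is uncovered in the first sum and one of \<open>D1 \<inter> C\<close> in the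
  second.\<close>

lemma min_complement_through:
  assumes C: "min_member \<C> C" "tip \<in> C"
  shows "min_member \<C> (sym_diff C (E - {tip}))"
proof -
  obtain D1 D2 where D: "min_member \<C> D1" "min_member \<C> D2" "D1 \<inter> D2 = {}"
    "D1 \<union> D2 = E - {tip}"
    using ex_decomposition sym_diff_eq by metis
  have subs: "D1 \<subseteq> E" "D2 \<subseteq> E" "C \<subseteq> E" using D C min_member_sub by blast+
  have tipD: "tip \<notin> D1" "tip \<notin> D2" using D(4) by blast+
  have D': "D2 \<inter> D1 = {}" "D2 \<union> D1 = E - {tip}" using D by blast+
  have n: "\<not> D1 \<subseteq> C" "\<not> D2 \<subseteq> C"
    using not_subset_min[OF D(1) C(1)] not_subset_min[OF D(2) C(1)] C tipD by blast+
  obtain x where x: "x \<in> D2" "x \<notin> C" using n by blast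
  have m: "C \<inter> D1 \<noteq> {}" "C \<inter> D2 \<noteq> {}"
    using meets_part[OF D C] meets_part[OF D(2,1) D' C] by blast+
  have CD: "min_member \<C> (sym_diff C D1)"
    using C(1) D(1) by (rule min_sym_diff[where x = x]) (use C tipD D x m subs in blast)+
  obtain y where y: "y \<in> D1" "y \<in> C" using m by blast
  have "min_member \<C> (sym_diff (sym_diff C D1) D2)"
    using CD D(2) by (rule min_sym_diff[where x = y]) (use C tipD D y m subs in blast)+
  moreover have "sym_diff (sym_diff C D1) D2 = sym_diff C (D1 \<union> D2)" using D(3) by blast
  ultimately show ?thesis unfolding D(4) by metis
qed

text \<open>Again \<open>D1\<close> and \<open>D2\<close> are added in turn, and \<open>tip\<close>
  itself is the uncovered element both times. If \<open>Z\<close> is one of the two portions, its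
  complement is the other.\<close>

lemma min_complement_avoiding:
  assumes Z: "min_member \<C> Z" "tip \<notin> Z"
  shows "min_member \<C> (E - {tip} - Z)"
proof -
  obtain D1 D2 where D: "min_member \<C> D1" "min_member \<C> D2" "D1 \<inter> D2 = {}"
    "D1 \<union> D2 = E - {tip}"
    using ex_decomposition sym_diff_eq by metis
  have subs: "D1 \<subseteq> E" "D2 \<subseteq> E" "Z \<subseteq> E" using D Z min_member_sub by blast+
  have tipD: "tip \<notin> D1" "tip \<notin> D2" using D(4) by blast+
  consider "Z = D1" | "Z = D2" | "Z \<noteq> D1" "Z \<noteq> D2" by blast
  then show ?thesis
  proof cases
    case 1
    then have "E - {tip} - Z = D2" using D by blast
    then show ?thesis using D by simp
  next
    case 2
    then have "E - {tip} - Z = D1" using D by blast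
    then show ?thesis using D by simp
  next
    case 3
    have m: "Z \<inter> D1 \<noteq> {}" "Z \<inter> D2 \<noteq> {}"
      using not_subset_min[OF Z(1) D(1)] not_subset_min[OF Z(1) D(2)] 3 D(4) Z subs by blast+
    have n: "\<not> D1 \<subseteq> Z" "\<not> D2 \<subseteq> Z"
      using not_subset_min[OF D(1) Z(1)] not_subset_min[OF D(2) Z(1)] 3 by blast+
    have ZD: "min_member \<C> (sym_diff Z D1)"
      using Z(1) D(1) by (rule min_sym_diff[where x = tip]) (use Z tipD tip_in_E 3 m in blast)+
    have "min_member \<C> (sym_diff (sym_diff Z D1) D2)"
      using ZD D(2) by (rule min_sym_diff[where x = tip]) (use Z tipD tip_in_E D m n in blast)+
    moreover have "sym_diff (sym_diff Z D1) D2 = E - {tip} - Z" using D Z subs by blast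
    ultimately show ?thesis by metis
  qed
qed

text \<open>Only a cycle \<open>D\<close> through \<open>tip\<close> with \<open>D - {tip}\<close>
  inside a circuit \<open>C\<close> avoiding \<open>tip\<close> could spoil minimality. But then
  \<open>C\<close> and \<open>E - {tip} - C\<close> decompose \<open>E - {tip}\<close> into two
  circuits, and \<open>meets_part\<close> forces a circuit through \<open>tip\<close> inside
  \<open>D\<close> to meet the second.\<close>

lemma min_member_contract:
  assumes C: "min_member \<C> C"
  shows "min_member ((\<lambda>C. C - {tip}) ` \<C>) (C - {tip})"
proof -
  have "D - {tip} = {} \<or> D - {tip} = C - {tip}" if D: "D \<in> \<C>" "D - {tip} \<subseteq> C - {tip}" for D
  proof (cases "tip \<in> D \<and> tip \<notin> C")
    case False
    then have "D \<subseteq> C" using D by blast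
    then show ?thesis using C D unfolding min_member_def by blast
  next
    case True
    obtain D' where D': "min_member \<C> D'" "tip \<in> D'" "D' \<subseteq> D"
      using min_member_through[OF D(1)] True by blast
    have c: "min_member \<C> (E - {tip} - C)" using min_complement_avoiding C True by blast
    have "C \<subseteq> E" using C min_member_sub by blast
    then have "D' \<inter> (E - {tip} - C) \<noteq> {}"
      using True by (intro meets_part[OF c C _ _ D'(1,2)]) blast+
    then show ?thesis using D' D by blast
  qed
  moreover have "C - {tip} \<noteq> {}"
    using min_member_mem[OF C] min_member_nonempty[OF C] tip_not_mem by (metis Diff_eq_empty_iff subset_singletonD)
  ultimately show ?thesis using C unfolding min_member_def by blast
qed

text \<open>A circuit of the contraction is the trace of a circuit \<open>C0\<close>. Its complement
  is the trace of the circuit that one of the two complement lemmas supplies, according to whether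
  \<open>tip\<close> lies in \<open>C0\<close>.\<close>

lemma contract_complementary:
  assumes K: "min_member ((\<lambda>C. C - {tip}) ` \<C>) K"
  shows "min_member ((\<lambda>C. C - {tip}) ` \<C>) (E - {tip} - K)"
proof -
  obtain C where C: "C \<in> \<C>" "K = C - {tip}" and "K \<noteq> {}" using K unfolding min_member_def by blast
  then obtain x where "x \<in> C" by blast
  then obtain C0 where C0: "min_member \<C> C0" "C0 \<subseteq> C"
    using min_member_through C(1) by blast
  have "C0 - {tip} \<noteq> {}"
    using min_member_nonempty[OF min_member_contract[OF C0(1)]] .
  then have K0: "K = C0 - {tip}"
    using C0(2) C(2) min_memberD[OF K, of "C0 - {tip}"] min_member_mem[OF C0(1)] by blast
  have sub: "C0 \<subseteq> E" using C0 min_member_sub by blast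
  show ?thesis
  proof (cases "tip \<in> C0")
    case True
    have "sym_diff C0 (E - {tip}) - {tip} = E - {tip} - K" using K0 sub by blast
    then show ?thesis
      using min_member_contract[OF min_complement_through[OF C0(1) True]] by metis
  next
    case False
    have "E - {tip} - C0 - {tip} = E - {tip} - K" using K0 sub by blast
    then show ?thesis
      using min_member_contract[OF min_complement_avoiding[OF C0(1) False]] by metis
  qed
qed

text \<open>This will give rank at least three: read as row vectors, \<open>C2\<close>,
  \<open>D1\<close> and \<open>D2\<close> isolate \<open>tip\<close>, a point of
  \<open>D1 - C2\<close> and a point of \<open>D2 - C2\<close>.\<close>

lemma ex_isolated_triple:
  obtains X where "X \<subseteq> E" "card X = 3" "\<And>x. x \<in> X \<Longrightarrow> \<exists>C\<in>\<C>. C \<inter> X = {x}"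
proof -
  obtain D1 D2 where D: "min_member \<C> D1" "min_member \<C> D2" "D1 \<inter> D2 = {}"
    "D1 \<union> D2 = E - {tip}"
    using ex_decomposition sym_diff_eq by metis
  have subs: "D1 \<subseteq> E" "D2 \<subseteq> E" using D min_member_sub by blast+
  have mem: "D1 \<in> \<C>" "D2 \<in> \<C>" "C1 \<in> \<C>" "C2 \<in> \<C>" using D C1 C2 min_member_mem by blast+
  have tips: "tip \<in> C1" "tip \<in> C2" "tip \<notin> D1" "tip \<notin> D2" using inter_eq D(4) by blast+
  have "\<not> D1 \<subseteq> C2" "\<not> D2 \<subseteq> C2"
    using not_subset_min[OF D(1) C2] not_subset_min[OF D(2) C2] tips by blast+
  then obtain x y where x: "x \<in> D1" "x \<notin> C2" and y: "y \<in> D2" "y \<notin> C2" by blast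
  let ?X = "{tip, x, y}"
  have "x \<noteq> y" "x \<noteq> tip" "y \<noteq> tip" using x y D(3) tips by blast+
  then have "card ?X = 3" by simp
  moreover have "?X \<subseteq> E" using x y subs tip_in_E by blast
  moreover have "C2 \<inter> ?X = {tip}" "D1 \<inter> ?X = {x}" "D2 \<inter> ?X = {y}" using x y tips D(3) by blast+
  then have "\<And>z. z \<in> ?X \<Longrightarrow> \<exists>C\<in>\<C>. C \<inter> ?X = {z}" using mem by blast
  ultimately show thesis using that by blast
qed

end

section \<open>Vector matroids and their duals\<close>

text \<open>A common form for a vector matroid, where the family is the kernel of the matrix, and
  for its dual, where it is the row space.\<close>

definition cycle_matroid :: "'a set \<Rightarrow> 'a set set \<Rightarrow> 'a matroid" where
  "cycle_matroid E \<C> = \<lparr>ground = E, indep = {I. I \<subseteq> E \<and> (\<forall>C\<in>\<C>. C \<subseteq> I \<longrightarrow> C = {})}\<rparr>"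

lemma circuit_cycle_matroid:
  assumes "\<And>C. C \<in> \<C> \<Longrightarrow> C \<subseteq> E"
  shows "circuit (cycle_matroid E \<C>) C \<longleftrightarrow> min_member \<C> C"
proof
  assume c: "circuit (cycle_matroid E \<C>) C"
  then obtain D where D: "D \<in> \<C>" "D \<subseteq> C" "D \<noteq> {}"
    unfolding circuit_def cycle_matroid_def by auto
  have sub: "D' = {}" if "D' \<in> \<C>" "D' \<subset> C" for D'
    using c that unfolding circuit_def cycle_matroid_def by auto
  have "D = C" using sub[OF D(1)] D by blast
  then show "min_member \<C> C" using D sub unfolding min_member_def by blast
next
  assume m: "min_member \<C> C"
  have "C \<in> \<C>" "C \<noteq> {}" and "\<And>D. D \<in> \<C> \<Longrightarrow> D \<subset> C \<Longrightarrow> D = {}"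
    using m unfolding min_member_def by blast+
  then show "circuit (cycle_matroid E \<C>) C"
    unfolding circuit_def cycle_matroid_def using assms[of C] by auto
qed

lemma ground_vector_matroid [simp]: "ground (vector_matroid E f) = E"
  by (simp add: vector_matroid_def)

lemma ground_dual [simp]: "ground (dual M) = ground M"
  by (simp add: dual_def)

lemma ground_delete [simp]: "ground (delete M X) = ground M - X"
  by (simp add: delete_def)

lemma delete_vector_matroid:
  "delete (vector_matroid E f) X = vector_matroid (E - X) f"
  unfolding delete_def vector_matroid_def by auto

lemma gf2_add_self [simp]: "v + v = (0 :: nat \<Rightarrow> bit)"
  by (simp add: fun_eq_iff)

lemma bit_neq_iff: "(c :: bit) \<noteq> 0 \<longleftrightarrow> c = 1"
  by (cases c) simp_all

lemma bit_add_eq_1_iff: "(c :: bit) + d = 1 \<longleftrightarrow> (c = 1 \<longleftrightarrow> d \<noteq> 1)"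
  by (cases c; cases d) simp_all

lemma gf2_scale_simps [simp]: "gf2_scale 1 v = v" "gf2_scale 0 v = 0"
  by (simp_all add: gf2_scale_def fun_eq_iff)

lemma sum_gf2_scale:
  assumes "finite A"
  shows "(\<Sum>x\<in>A. gf2_scale (u x) (g x)) = sum g {x\<in>A. u x = 1}"
proof -
  have "(\<Sum>x\<in>A. gf2_scale (u x) (g x)) = (\<Sum>x\<in>A. if u x = 1 then g x else 0)"
  proof (rule sum.cong)
    fix x
    show "gf2_scale (u x) (g x) = (if u x = 1 then g x else 0)"
      by (cases "u x") auto
  qed simp
  then show ?thesis using assms by (simp add: sum.inter_filter)
qed

text \<open>Over GF(2) a linear combination is a subset sum, so dependence means that some nonempty
  set of columns sums to zero. A repeated column is a two-element instance, which accounts for the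
  injectivity condition.\<close>

lemma vector_matroid_eq_cycle_matroid:
  assumes "finite E"
  shows "vector_matroid E f = cycle_matroid E {J. J \<subseteq> E \<and> sum f J = 0}"
proof -
  have key: "inj_on f I \<and> gf2.independent (f ` I) \<longleftrightarrow> (\<forall>J. J \<subseteq> I \<longrightarrow> sum f J = 0 \<longrightarrow> J = {})"
    if I: "I \<subseteq> E" for I
  proof (intro iffI conjI allI impI)
    fix J assume a: "inj_on f I \<and> gf2.independent (f ` I)" and J: "J \<subseteq> I" "sum f J = 0"
    have fin: "finite J" using J I assms by (meson finite_subset)
    have inj: "inj_on f J" using a J inj_on_subset by blast
    have "(\<Sum>v\<in>f ` J. gf2_scale 1 v) = 0"
      using J(2) by (simp add: sum.reindex[OF inj] o_def)
    moreover have "gf2.independent (f ` J)"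
      using a gf2.independent_mono[of "f ` I" "f ` J"] J by blast
    ultimately have "\<not> (\<exists>v\<in>f ` J. (1::bit) \<noteq> 0)"
      using gf2.dependent_finite[of "f ` J"] fin
        exI[of "\<lambda>u. (\<exists>v\<in>f ` J. u v \<noteq> 0) \<and> (\<Sum>v\<in>f ` J. gf2_scale (u v) v) = 0" "\<lambda>_. 1"]
      by blast
    then show "J = {}" by auto
  next
    assume a: "\<forall>J. J \<subseteq> I \<longrightarrow> sum f J = 0 \<longrightarrow> J = {}"
    show inj: "inj_on f I"
    proof (rule inj_onI, rule ccontr)
      fix x y assume xy: "x \<in> I" "y \<in> I" "f x = f y" "x \<noteq> y"
      then have "sum f {x, y} = 0" by simp
      then show False using a[rule_format, of "{x, y}"] xy by simp
    qed
    have fin: "finite I" using I assms by (meson finite_subset)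
    show "gf2.independent (f ` I)"
    proof (rule ccontr)
      assume "\<not> ?thesis"
      then obtain u where u: "\<exists>v\<in>f ` I. u v \<noteq> 0" "(\<Sum>v\<in>f ` I. gf2_scale (u v) v) = 0"
        using gf2.dependent_finite[of "f ` I"] fin by blast
      have "sum f {x\<in>I. u (f x) = 1} = (\<Sum>x\<in>I. gf2_scale (u (f x)) (f x))"
        by (rule sum_gf2_scale[OF fin, symmetric])
      also have "\<dots> = (\<Sum>v\<in>f ` I. gf2_scale (u v) v)"
        by (simp only: sum.reindex[OF inj] o_def)
      finally have "sum f {x\<in>I. u (f x) = 1} = 0" using u(2) by (rule trans)
      moreover have "{x\<in>I. u (f x) = 1} \<subseteq> I" by auto
      ultimately have "{x\<in>I. u (f x) = 1} = {}" using a by metis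
      then show False using u(1) by (auto simp: bit_neq_iff)
    qed
  qed
  have "I \<subseteq> E \<and> inj_on f I \<and> gf2.independent (f ` I) \<longleftrightarrow>
      I \<subseteq> E \<and> (\<forall>C\<in>{J. J \<subseteq> E \<and> sum f J = 0}. C \<subseteq> I \<longrightarrow> C = {})" for I
  proof (rule conj_cong[OF refl])
    assume I: "I \<subseteq> E"
    have "(\<forall>J. J \<subseteq> I \<longrightarrow> sum f J = 0 \<longrightarrow> J = {}) \<longleftrightarrow>
        (\<forall>C\<in>{J. J \<subseteq> E \<and> sum f J = 0}. C \<subseteq> I \<longrightarrow> C = {})"
      by (metis (mono_tags, lifting) I mem_Collect_eq order_trans)
    then show "inj_on f I \<and> gf2.independent (f ` I) \<longleftrightarrow>
        (\<forall>C\<in>{J. J \<subseteq> E \<and> sum f J = 0}. C \<subseteq> I \<longrightarrow> C = {})"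
      using key[OF I] by (rule trans[rotated])
  qed
  then show ?thesis
    unfolding vector_matroid_def cycle_matroid_def by simp
qed

lemma matroid_vector_matroid:
  assumes "finite E"
  shows "matroid (vector_matroid E f)"
proof
  fix I J assume I: "I \<in> indep (vector_matroid E f)" and J: "J \<in> indep (vector_matroid E f)"
    and less: "card I < card J"
  have I': "I \<subseteq> E" "inj_on f I" "gf2.independent (f ` I)"
    and J': "J \<subseteq> E" "inj_on f J" "gf2.independent (f ` J)"
    using I J by (auto simp: vector_matroid_def)
  have fin: "finite I" "finite J" using I' J' assms finite_subset by blast+
  have "\<not> f ` J \<subseteq> gf2.span (f ` I)"
  proof
    assume "f ` J \<subseteq> gf2.span (f ` I)"
    then have "card (f ` J) \<le> card (f ` I)"
      using gf2.independent_span_bound[of "f ` I" "f ` J"] fin J' by blast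
    then show False using less I' J' by (simp add: card_image)
  qed
  then obtain x where x: "x \<in> J" "f x \<notin> gf2.span (f ` I)" by blast
  then have "f x \<notin> f ` I" using gf2.span_base by blast
  then have "insert x I \<in> indep (vector_matroid E f)" and "x \<notin> I"
    using I' J' x gf2.independent_insertI[of "f x" "f ` I"] by (auto simp: vector_matroid_def)
  then show "\<exists>x\<in>J - I. insert x I \<in> indep (vector_matroid E f)" using x by blast
next
  fix I J assume "I \<in> indep (vector_matroid E f)" and "J \<subseteq> I"
  then show "J \<in> indep (vector_matroid E f)"
    using gf2.independent_mono[of "f ` I" "f ` J"] by (auto simp: vector_matroid_def intro: inj_on_subset)
qed (use assms in \<open>auto simp: vector_matroid_def gf2.independent_empty\<close>)

text \<open>For varying \<open>a\<close> these are all the linear functionals on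
  \<open>gf2_space n\<close>. Entries of \<open>a\<close> from \<open>n\<close> on are ignored, so
  \<open>a\<close> may range over all sequences.\<close>

definition dot :: "nat \<Rightarrow> (nat \<Rightarrow> bit) \<Rightarrow> (nat \<Rightarrow> bit) \<Rightarrow> bit" where
  "dot n a v = (\<Sum>i<n. a i * v i)"

lemma dot_add_left: "dot n (a + b) v = dot n a v + dot n b v"
  by (simp only: dot_def plus_fun_apply sum.distrib distrib_right)

lemma dot_add_right: "dot n a (v + w) = dot n a v + dot n a w"
  by (simp only: dot_def plus_fun_apply sum.distrib distrib_left)

lemma dot_zero [simp]: "dot n 0 v = 0" "dot n a 0 = 0"
  by (simp_all add: dot_def)

lemma dot_scale_right: "dot n a (gf2_scale c v) = c * dot n a v"
  by (cases c) simp_all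

lemma dot_eq_0_span:
  assumes "v \<in> gf2.span W" "\<And>w. w \<in> W \<Longrightarrow> dot n a w = 0"
  shows "dot n a v = 0"
proof -
  have "gf2.subspace {v. dot n a v = 0}"
    by (rule gf2.subspaceI) (auto simp: dot_add_right dot_scale_right)
  then show ?thesis using gf2.span_minimal[of W "{v. dot n a v = 0}"] assms by blast
qed

section \<open>Coordinates, dimension and linear functionals over GF(2)\<close>

definition unit_vec :: "nat \<Rightarrow> nat \<Rightarrow> bit" where
  "unit_vec i = (\<lambda>j. if j = i then 1 else 0)"

lemma unit_vec_in_space: "i < n \<Longrightarrow> unit_vec i \<in> gf2_space n"
  by (auto simp: unit_vec_def gf2_space_def)

lemma dot_unit_vec: "i < n \<Longrightarrow> dot n a (unit_vec i) = a i"
  by (simp only: dot_def unit_vec_def if_distrib[of "\<lambda>x. _ * x"] mult_1_right mult_zero_right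
      sum.delta finite_lessThan lessThan_iff if_True)

lemma sum_fun_apply: "sum g A x = (\<Sum>y\<in>A. g y x)" for g :: "'b \<Rightarrow> 'c \<Rightarrow> 'd::comm_monoid_add"
  by (induction A rule: infinite_finite_induct) auto

lemma gf2_space_expand:
  assumes "v \<in> gf2_space n"
  shows "v = (\<Sum>i<n. gf2_scale (v i) (unit_vec i))"
proof
  fix j
  have "(\<Sum>i<n. gf2_scale (v i) (unit_vec i)) j = (\<Sum>i<n. if j = i then v i else 0)"
    unfolding sum_fun_apply by (intro sum.cong) (auto simp: gf2_scale_def unit_vec_def)
  also have "\<dots> = v j" using assms by (auto simp: gf2_space_def)
  finally show "v j = (\<Sum>i<n. gf2_scale (v i) (unit_vec i)) j" by simp
qed

lemma subspace_gf2_space: "gf2.subspace (gf2_space n)"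
  by (rule gf2.subspaceI) (auto simp: gf2_space_def gf2_scale_def)

lemma gf2_space_subset_span:
  assumes "\<And>i. i < n \<Longrightarrow> unit_vec i \<in> gf2.span W"
  shows "gf2_space n \<subseteq> gf2.span W"
proof
  fix v assume "v \<in> gf2_space n"
  then show "v \<in> gf2.span W"
    using assms by (subst gf2_space_expand) (auto intro!: gf2.span_sum gf2.span_scale)
qed

lemma span_unit_vecs: "gf2.span (unit_vec ` {..<n}) = gf2_space n"
proof
  show "gf2.span (unit_vec ` {..<n}) \<subseteq> gf2_space n"
    using unit_vec_in_space by (intro gf2.span_minimal subspace_gf2_space) auto
  show "gf2_space n \<subseteq> gf2.span (unit_vec ` {..<n})"
    by (intro gf2_space_subset_span gf2.span_base) auto
qed

lemma inj_unit_vec: "inj unit_vec"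
  by (rule injI) (metis unit_vec_def zero_neq_one)

lemma independent_unit_vecs: "gf2.independent (unit_vec ` {..<n})"
proof (rule ccontr)
  assume "\<not> ?thesis"
  then obtain u where u: "\<exists>v\<in>unit_vec ` {..<n}. u v \<noteq> 0"
      "(\<Sum>v\<in>unit_vec ` {..<n}. gf2_scale (u v) v) = 0"
    using gf2.dependent_finite[of "unit_vec ` {..<n}"] by blast
  then obtain j where j: "j < n" "u (unit_vec j) = 1" by (auto simp: bit_neq_iff)
  have "0 = (\<Sum>i<n. gf2_scale (u (unit_vec i)) (unit_vec i)) j"
    using u(2) by (simp add: sum.reindex inj_on_subset[OF inj_unit_vec] o_def)
  also have "\<dots> = (\<Sum>i<n. if j = i then u (unit_vec i) else 0)"
    unfolding sum_fun_apply by (intro sum.cong) (auto simp: gf2_scale_def unit_vec_def)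
  also have "\<dots> = 1" using j by simp
  finally show False by simp
qed

lemma dim_gf2_space: "gf2.dim (gf2_space n) = n"
proof (rule gf2.dim_unique)
  show "unit_vec ` {..<n} \<subseteq> gf2_space n" using unit_vec_in_space by auto
  show "card (unit_vec ` {..<n}) = n" by (simp add: card_image inj_on_subset[OF inj_unit_vec])
qed (simp_all add: span_unit_vecs independent_unit_vecs)

lemma card_independent_le:
  assumes "gf2.independent S" "S \<subseteq> gf2_space n"
  shows "finite S \<and> card S \<le> n"
  using gf2.independent_span_bound[of "unit_vec ` {..<n}" S] assms span_unit_vecs[of n]
    card_image_le[of "{..<n}" unit_vec] by fastforce

lemma independent_spanning:
  assumes "gf2.independent S" "S \<subseteq> gf2_space n" "card S = n"
  shows "gf2_space n \<subseteq> gf2.span S"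
proof (rule ccontr)
  assume "\<not> ?thesis"
  then obtain v where v: "v \<in> gf2_space n" "v \<notin> gf2.span S" by blast
  then have "gf2.independent (insert v S)" using assms gf2.independent_insertI by blast
  then have "card (insert v S) \<le> n" using card_independent_le assms v by blast
  moreover have "v \<notin> S" using v gf2.span_base by blast
  ultimately show False using card_independent_le[OF assms(1,2)] assms(3) by simp
qed

text \<open>A basis of the span of \<open>W\<close> stays independent when \<open>v\<close> is
  added, so a linear map may be prescribed as zero on the basis and one at \<open>v\<close>.\<close>

lemma separating_functional:
  assumes "v \<in> gf2_space n" "W \<subseteq> gf2_space n" "v \<notin> gf2.span W"
  obtains a where "\<And>w. w \<in> W \<Longrightarrow> dot n a w = 0" "dot n a v = 1"
proof -
  interpret vector_space_pair gf2_scale "(*) :: bit \<Rightarrow> bit \<Rightarrow> bit"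
    by unfold_locales (auto simp: algebra_simps)
  obtain B where B: "B \<subseteq> W" "gf2.independent B" "W \<subseteq> gf2.span B"
    by (rule gf2.maximal_independent_subset)
  have "v \<notin> gf2.span B" using assms(3) B(1) gf2.span_mono by blast
  then have vB: "gf2.independent (insert v B)" "v \<notin> B"
    using B gf2.independent_insertI gf2.span_base by blast+
  then obtain g where g: "Vector_Spaces.linear gf2_scale (*) g"
    "\<forall>x\<in>insert v B. g x = (if x = v then 1 else 0)"
    using linear_independent_extend[of "insert v B" "\<lambda>x. if x = v then 1 else 0"] by blast
  \<comment> \<open>The row vector of a functional consists of its values at the unit
    vectors.\<close>
  define a where "a = (\<lambda>i. g (unit_vec i))"
  have dot: "dot n a u = g u" if "u \<in> gf2_space n" for u
  proof -
    have "g u = g (\<Sum>i<n. gf2_scale (u i) (unit_vec i))"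
      using gf2_space_expand[OF that] by simp
    also have "\<dots> = (\<Sum>i<n. u i * g (unit_vec i))"
      using linear_sum[OF g(1), of "\<lambda>i. gf2_scale (u i) (unit_vec i)" "{..<n}"]
        linear_scale[OF g(1)] by simp
    finally show ?thesis by (simp only: dot_def a_def mult.commute)
  qed
  show thesis
  proof (rule that[of a])
    show "dot n a v = 1" using dot g assms by simp
    fix w assume w: "w \<in> W"
    have "B \<subseteq> gf2_space n" using B assms by blast
    then have "dot n a b = 0" if "b \<in> B" for b using that dot[of b] g vB by auto
    then show "dot n a w = 0" using dot_eq_0_span[of w B n a] w B by blast
  qed
qed

text \<open>The row space of the matrix with columns \<open>f x\<close>, each row vector read as a subset of \<open>E\<close>.\<close>

definition supports :: "nat \<Rightarrow> 'a set \<Rightarrow> ('a \<Rightarrow> nat \<Rightarrow> bit) \<Rightarrow> 'a set set" where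
  "supports n E f = range (\<lambda>a. {x\<in>E. dot n a (f x) = 1})"

lemma supportsI: "{x\<in>E. dot n a (f x) = 1} \<in> supports n E f"
  unfolding supports_def by blast

lemma cycle_space_supports: "finite E \<Longrightarrow> cycle_space E (supports n E f)"
proof
  show "{} \<in> supports n E f" using supportsI[of E n 0 f] by simp
  fix C D assume "C \<in> supports n E f" "D \<in> supports n E f"
  then obtain a b where "C = {x\<in>E. dot n a (f x) = 1}" "D = {x\<in>E. dot n b (f x) = 1}"
    unfolding supports_def by blast
  then have "sym_diff C D = {x\<in>E. dot n (a + b) (f x) = 1}"
    by (auto simp: dot_add_left bit_add_eq_1_iff)
  then show "sym_diff C D \<in> supports n E f" using supportsI by metis
qed (auto simp: supports_def)

lemma basis_vector_matroid:
  "basis (vector_matroid E f) B \<longleftrightarrow>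
    B \<subseteq> E \<and> inj_on f B \<and> gf2.independent (f ` B) \<and> f ` E \<subseteq> gf2.span (f ` B)" (is "?L \<longleftrightarrow> ?R")
proof
  assume L: ?L
  then have B: "B \<subseteq> E" "inj_on f B" "gf2.independent (f ` B)"
    by (auto simp: basis_def vector_matroid_def)
  have "f x \<in> gf2.span (f ` B)" if x: "x \<in> E" for x
  proof (rule ccontr)
    assume n: "f x \<notin> gf2.span (f ` B)"
    then have "f x \<notin> f ` B" using gf2.span_base by blast
    then have "insert x B \<in> indep (vector_matroid E f)"
      using B x n gf2.independent_insertI[of "f x" "f ` B"] by (auto simp: vector_matroid_def)
    then have "insert x B = B" using L unfolding basis_def by blast
    then show False using \<open>f x \<notin> f ` B\<close> by blast
  qed
  then show ?R using B by blast
next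
  assume R: ?R
  have "I = B" if I: "I \<in> indep (vector_matroid E f)" "B \<subseteq> I" for I
  proof (rule ccontr)
    assume "I \<noteq> B"
    then obtain x where x: "x \<in> I" "x \<notin> B" using I by blast
    have I': "I \<subseteq> E" "inj_on f I" "gf2.independent (f ` I)"
      using I by (auto simp: vector_matroid_def)
    have "f x \<in> gf2.span (f ` B)" using R I' x by blast
    moreover have "f ` B \<subseteq> f ` I - {f x}"
      using I I' x by (auto dest: inj_onD)
    ultimately have "f x \<in> gf2.span (f ` I - {f x})" using gf2.span_mono by blast
    then show False using I' x unfolding gf2.dependent_def by blast
  qed
  then show ?L using R by (auto simp: basis_def vector_matroid_def)
qed

text \<open>A set is independent in the dual exactly if the columns outside it still span all
  columns. If they do, a functional vanishing on them vanishes on every column; if they do not, a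
  separating functional has a nonempty support inside the set.\<close>

lemma dual_vector_matroid:
  assumes "f ` E \<subseteq> gf2_space n"
  shows "dual (vector_matroid E f) = cycle_matroid E (supports n E f)"
proof -
  have "(\<exists>B. basis (vector_matroid E f) B \<and> I \<subseteq> E - B) \<longleftrightarrow>
      I \<subseteq> E \<and> (\<forall>C\<in>supports n E f. C \<subseteq> I \<longrightarrow> C = {})" for I
  proof (intro iffI conjI ballI impI)
    assume "\<exists>B. basis (vector_matroid E f) B \<and> I \<subseteq> E - B"
    then obtain B where B: "basis (vector_matroid E f) B" "I \<subseteq> E - B" by blast
    show "I \<subseteq> E" using B by blast
    fix C assume C: "C \<in> supports n E f" "C \<subseteq> I"
    obtain a where a: "C = {x\<in>E. dot n a (f x) = 1}" using C unfolding supports_def by blast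
    have "dot n a (f x) = 0" if x: "x \<in> E" for x
    proof (rule dot_eq_0_span)
      show "f x \<in> gf2.span (f ` B)" using B x unfolding basis_vector_matroid by blast
      fix w assume "w \<in> f ` B"
      then obtain b where b: "w = f b" "b \<in> B" by blast
      then have "b \<in> E" "b \<notin> C" using B C unfolding basis_vector_matroid by blast+
      then show "dot n a w = 0" using a b bit_neq_iff by blast
    qed
    then show "C = {}" using a by simp
  next
    assume I: "I \<subseteq> E \<and> (\<forall>C\<in>supports n E f. C \<subseteq> I \<longrightarrow> C = {})"
    have sp: "f x \<in> gf2.span (f ` (E - I))" if x: "x \<in> E" for x
    proof (rule ccontr)
      assume nx: "f x \<notin> gf2.span (f ` (E - I))"
      have "f x \<in> gf2_space n" "f ` (E - I) \<subseteq> gf2_space n" using assms x by blast+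
      then obtain a where a: "\<And>w. w \<in> f ` (E - I) \<Longrightarrow> dot n a w = 0" "dot n a (f x) = 1"
        using nx by (rule separating_functional) blast
      have "{y\<in>E. dot n a (f y) = 1} \<subseteq> I"
      proof
        fix y assume y: "y \<in> {y\<in>E. dot n a (f y) = 1}"
        show "y \<in> I"
        proof (rule ccontr)
          assume "y \<notin> I"
          then have "dot n a (f y) = 0" using a(1)[of "f y"] y by simp
          then show False using y by simp
        qed
      qed
      then have "{y\<in>E. dot n a (f y) = 1} = {}" using I supportsI[of E n a f] by blast
      then show False using a(2) x by blast
    qed
    obtain B0 where B0: "B0 \<subseteq> f ` (E - I)" "gf2.independent B0" "f ` (E - I) \<subseteq> gf2.span B0"
      by (rule gf2.maximal_independent_subset)
    then obtain B where B: "B \<subseteq> E - I" "inj_on f B" "B0 = f ` B"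
      by (meson subset_image_inj)
    have "gf2.span (f ` (E - I)) \<subseteq> gf2.span B0"
      using B0 by (simp add: gf2.span_minimal)
    then have "basis (vector_matroid E f) B"
      unfolding basis_vector_matroid using B B0 sp by blast
    then show "\<exists>B. basis (vector_matroid E f) B \<and> I \<subseteq> E - B" using B I by blast
  qed
  then show ?thesis unfolding dual_def cycle_matroid_def by simp
qed

section \<open>Bases, rank and hyperplanes\<close>

lemma (in matroid) finite_indep: "I \<in> indep M \<Longrightarrow> finite I"
  using indep_subset_ground finite_ground finite_subset by blast

lemma (in matroid) indep_in_basis:
  assumes "I \<in> indep M"
  obtains B where "basis M B" "I \<subseteq> B"
proof -
  have fin: "finite (indep M)"
    using finite_ground indep_subset_ground by (auto intro: finite_subset[of _ "Pow (ground M)"])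
  obtain B where "B \<in> indep M" "I \<subseteq> B" "\<forall>J\<in>indep M. B \<subseteq> J \<longrightarrow> B = J"
    using finite_has_maximal2[OF fin assms] by blast
  then have "basis M B" unfolding basis_def by metis
  then show thesis using that \<open>I \<subseteq> B\<close> by blast
qed

lemma (in matroid) card_indep_le_basis:
  assumes "basis M B" "I \<in> indep M"
  shows "card I \<le> card B"
proof (rule ccontr)
  assume "\<not> ?thesis"
  then obtain x where "x \<in> I - B" "insert x B \<in> indep M"
    using indep_augment[of B I] assms unfolding basis_def by auto
  then show False using assms unfolding basis_def by blast
qed

lemma (in matroid) basis_if_card:
  assumes B: "basis M B" and I: "I \<in> indep M" and card: "card B \<le> card I"
  shows "basis M I"
proof -
  obtain B' where B': "basis M B'" "I \<subseteq> B'" using indep_in_basis[OF I] .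
  have "card B' \<le> card B" using card_indep_le_basis[OF B] B' unfolding basis_def by blast
  then have "I = B'"
    using card B' finite_indep card_seteq[of B' I] unfolding basis_def by auto
  then show ?thesis using B' by simp
qed

lemma (in matroid) finite_card_indep: "finite (card ` {I \<in> indep M. I \<subseteq> X})"
proof (rule finite_imageI)
  show "finite {I \<in> indep M. I \<subseteq> X}"
    using finite_ground indep_subset_ground by (auto intro: finite_subset[of _ "Pow (ground M)"])
qed

lemma (in matroid) card_indep_le_rank: "I \<in> indep M \<Longrightarrow> I \<subseteq> X \<Longrightarrow> card I \<le> rank M X"
  unfolding rank_def using finite_card_indep by (intro Max_ge) auto

lemma (in matroid) rank_attained:
  obtains I where "I \<in> indep M" "I \<subseteq> X" "card I = rank M X"
proof -
  have "rank M X \<in> card ` {I \<in> indep M. I \<subseteq> X}"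
    unfolding rank_def using finite_card_indep empty_indep by (intro Max_in) auto
  then show thesis using that by auto
qed

lemma (in matroid) rank_ground:
  assumes "basis M B"
  shows "rank M (ground M) = card B"
proof (rule antisym)
  obtain I where "I \<in> indep M" "card I = rank M (ground M)" using rank_attained by metis
  then show "rank M (ground M) \<le> card B" using card_indep_le_basis[OF assms] by metis
  show "card B \<le> rank M (ground M)"
    using assms card_indep_le_rank indep_subset_ground unfolding basis_def by blast
qed

lemma (in matroid) rank_eq_ground_iff:
  assumes "X \<subseteq> ground M"
  shows "rank M (ground M) \<le> rank M X \<longleftrightarrow> (\<exists>B. basis M B \<and> B \<subseteq> X)"
proof
  assume le: "rank M (ground M) \<le> rank M X"
  obtain B where B: "basis M B" using indep_in_basis[OF empty_indep] by blast
  obtain I where I: "I \<in> indep M" "I \<subseteq> X" "card I = rank M X" by (rule rank_attained)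
  have "basis M I" by (rule basis_if_card[OF B I(1)]) (use le rank_ground[OF B] I in simp)
  then show "\<exists>B. basis M B \<and> B \<subseteq> X" using I by blast
next
  assume "\<exists>B. basis M B \<and> B \<subseteq> X"
  then obtain B where B: "basis M B" "B \<subseteq> X" by blast
  then show "rank M (ground M) \<le> rank M X"
    using rank_ground[OF B(1)] card_indep_le_rank[of B X] unfolding basis_def by simp
qed

lemma indep_dual: "I \<in> indep (dual M) \<longleftrightarrow> (\<exists>B. basis M B \<and> I \<subseteq> ground M - B)"
  by (simp add: dual_def)

lemma (in matroid) basis_sub: "basis M B \<Longrightarrow> B \<subseteq> ground M"
  unfolding basis_def using indep_subset_ground by blast

lemma (in matroid) basis_dual: "basis (dual M) B' \<longleftrightarrow> B' \<subseteq> ground M \<and> basis M (ground M - B')"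
proof
  assume L: "basis (dual M) B'"
  then obtain B where B: "basis M B" "B' \<subseteq> ground M - B" unfolding basis_def indep_dual by blast
  then have "ground M - B \<in> indep (dual M)" unfolding indep_dual by blast
  then have "ground M - B = B'" using L B unfolding basis_def by blast
  then show "B' \<subseteq> ground M \<and> basis M (ground M - B')"
    using B basis_sub[OF B(1)] by (auto simp: double_diff)
next
  assume R: "B' \<subseteq> ground M \<and> basis M (ground M - B')"
  have "B' \<in> indep (dual M)" unfolding indep_dual using R by blast
  moreover have "I = B'" if I: "I \<in> indep (dual M)" "B' \<subseteq> I" for I
  proof -
    obtain B where B: "basis M B" "I \<subseteq> ground M - B" using I unfolding indep_dual by blast
    have "B \<subseteq> ground M - B'" using B I basis_sub by blast
    then have "ground M - B' = B" using B R unfolding basis_def by blast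
    then show ?thesis using B I R by blast
  qed
  ultimately show "basis (dual M) B'" unfolding basis_def by blast
qed

lemma (in matroid) dual_dual: "dual (dual M) = M"
proof -
  have "I \<in> indep (dual (dual M)) \<longleftrightarrow> I \<in> indep M" for I
  proof
    assume "I \<in> indep (dual (dual M))"
    then obtain B' where "basis M (ground M - B')" "I \<subseteq> ground M - B'"
      unfolding indep_dual basis_dual by auto
    then show "I \<in> indep M" using indep_subset unfolding basis_def by blast
  next
    assume "I \<in> indep M"
    then obtain B where B: "basis M B" "I \<subseteq> B" by (rule indep_in_basis)
    have "basis (dual M) (ground M - B)" "I \<subseteq> ground M - (ground M - B)"
      using B basis_sub[OF B(1)] by (auto simp: basis_dual double_diff)
    then show "I \<in> indep (dual (dual M))" unfolding indep_dual[of I "dual M"] by auto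
  qed
  then have "indep (dual (dual M)) = indep M" by blast
  moreover have "ground (dual (dual M)) = ground M" by simp
  ultimately show ?thesis by (simp add: matroid.equality)
qed

text \<open>A set is dependent in the dual exactly if its complement contains no basis. Hyperplanes
  are the maximal sets without a basis, and cocircuits the minimal sets that meet every
  basis.\<close>

lemma (in matroid) hyperplane_iff_cocircuit:
  "hyperplane M H \<longleftrightarrow> H \<subseteq> ground M \<and> circuit (dual M) (ground M - H)"
proof -
  let ?E = "ground M"
  have dep: "D \<notin> indep (dual M) \<longleftrightarrow> (\<nexists>B. basis M B \<and> B \<subseteq> ?E - D)" if "D \<subseteq> ?E" for D
    unfolding indep_dual using that basis_sub by blast
  show ?thesis
  proof
    assume h: "hyperplane M H"
    then have H: "H \<subseteq> ?E" "closure M H = H" and r: "Suc (rank M H) = rank M ?E"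
      unfolding hyperplane_def flat_def by blast+
    have "?E - (?E - H) = H" using H by blast
    then have 1: "?E - H \<notin> indep (dual M)"
      using dep[of "?E - H"] rank_eq_ground_iff[OF H(1)] r by auto
    have 2: "D \<in> indep (dual M)" if D: "D \<subset> ?E - H" for D
    proof -
      obtain x where x: "x \<in> ?E - H" "x \<notin> D" using D by blast
      then have "rank M (insert x H) \<noteq> rank M H" using H unfolding closure_def by blast
      moreover obtain I where I: "I \<in> indep M" "I \<subseteq> H" "card I = rank M H" by (rule rank_attained)
      then have "rank M H \<le> rank M (insert x H)"
        using card_indep_le_rank[of I "insert x H"] by auto
      ultimately have "rank M ?E \<le> rank M (insert x H)" using r by linarith
      then obtain B where "basis M B" "B \<subseteq> insert x H"
        using rank_eq_ground_iff[of "insert x H"] H x by auto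
      then show ?thesis unfolding indep_dual using D x basis_sub by blast
    qed
    show "H \<subseteq> ?E \<and> circuit (dual M) (?E - H)"
      unfolding circuit_def using H 1 2 by simp
  next
    assume R: "H \<subseteq> ?E \<and> circuit (dual M) (?E - H)"
    then have H: "H \<subseteq> ?E" and 1: "?E - H \<notin> indep (dual M)"
      and 2: "\<And>D. D \<subset> ?E - H \<Longrightarrow> D \<in> indep (dual M)"
      unfolding circuit_def by blast+
    have "?E - (?E - H) = H" using H by blast
    then have nb: "\<nexists>B. basis M B \<and> B \<subseteq> H"
      using 1 dep[of "?E - H"] by auto
    have ins: "\<exists>B. basis M B \<and> B \<subseteq> insert x H" if x: "x \<in> ?E" "x \<notin> H" for x
    proof -
      have "?E - H - {x} \<in> indep (dual M)" using 2[of "?E - H - {x}"] x by blast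
      then show ?thesis unfolding indep_dual using basis_sub by blast
    qed
    obtain B0 where "basis M B0" using indep_in_basis[OF empty_indep] by blast
    then obtain x where x: "x \<in> ?E" "x \<notin> H" using nb basis_sub by blast
    obtain B where B: "basis M B" "B \<subseteq> insert x H" using ins[OF x] by blast
    have Bi: "B \<in> indep M" using B(1) unfolding basis_def by blast
    have finB: "finite B" using finite_indep[OF Bi] .
    \<comment> \<open>The basis in \<open>insert x H\<close> must use \<open>x\<close>; what remains
      is an independent subset of \<open>H\<close> with one element less, so the rank of
      \<open>H\<close> falls short by at most one.\<close>
    have xB: "x \<in> B" using B nb by blast
    have "B - {x} \<in> indep M" using indep_subset[OF Bi] by blast
    then have "card (B - {x}) \<le> rank M H" using card_indep_le_rank[of "B - {x}" H] B by blast
    then have "rank M ?E \<le> Suc (rank M H)"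
      using rank_ground[OF B(1)] xB finB by (simp add: card_Diff_singleton)
    moreover have "\<not> rank M ?E \<le> rank M H" using rank_eq_ground_iff[OF H] nb by blast
    ultimately have r: "Suc (rank M H) = rank M ?E" by simp
    have "rank M (insert y H) \<noteq> rank M H" if y: "y \<in> ?E" "y \<notin> H" for y
      using rank_eq_ground_iff[of "insert y H"] ins[OF y] y H r by auto
    moreover have "rank M (insert y H) = rank M H" if "y \<in> H" for y
      using that by (simp add: insert_absorb)
    ultimately have "closure M H = H" unfolding closure_def using H by blast
    then show "hyperplane M H" unfolding hyperplane_def flat_def using H r by blast
  qed
qed

section \<open>Hyperplanes, complementarity and rank read off a representation\<close>

lemma hyperplane_vector_matroid:
  assumes "finite E" "f ` E \<subseteq> gf2_space n"
  shows "hyperplane (vector_matroid E f) H \<longleftrightarrow> H \<subseteq> E \<and> min_member (supports n E f) (E - H)"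
proof -
  interpret matroid "vector_matroid E f" using assms by (intro matroid_vector_matroid)
  interpret cycle_space E "supports n E f" using assms by (intro cycle_space_supports)
  show ?thesis
    using hyperplane_iff_cocircuit dual_vector_matroid[OF assms(2)] circuit_cycle_matroid[OF sub_E]
    by simp
qed

lemma hyperplane_complementary_vector_matroid:
  assumes "finite E" "f ` E \<subseteq> gf2_space n"
  shows "hyperplane_complementary (vector_matroid E f) \<longleftrightarrow>
    (\<forall>K. min_member (supports n E f) K \<longrightarrow> min_member (supports n E f) (E - K))"
proof -
  interpret cycle_space E "supports n E f" using assms by (intro cycle_space_supports)
  have dd: "E - (E - X) = X" if "X \<subseteq> E" for X using that by blast
  show ?thesis
    unfolding hyperplane_complementary_def hyperplane_vector_matroid[OF assms] ground_vector_matroid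
  proof (intro iffI allI impI)
    fix K assume a: "\<forall>H. H \<subseteq> E \<and> min_member (supports n E f) (E - H) \<longrightarrow>
        E - H \<subseteq> E \<and> min_member (supports n E f) (E - (E - H))"
      and K: "min_member (supports n E f) K"
    show "min_member (supports n E f) (E - K)"
      using a[rule_format, of "E - K"] K dd[OF min_member_sub[OF K]] by auto
  next
    fix H assume a: "\<forall>K. min_member (supports n E f) K \<longrightarrow> min_member (supports n E f) (E - K)"
      and H: "H \<subseteq> E \<and> min_member (supports n E f) (E - H)"
    then show "E - H \<subseteq> E \<and> min_member (supports n E f) (E - (E - H))" by blast
  qed
qed

lemma supports_image:
  "supports n (f ` E) (\<lambda>v. v) = (`) f ` supports n E f"
  unfolding supports_def by (auto simp: image_image intro!: image_eqI)

lemma min_member_image: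
  assumes inj: "inj_on f E" and sub: "\<And>C. C \<in> \<C> \<Longrightarrow> C \<subseteq> E" and C: "C \<subseteq> E"
  shows "min_member ((`) f ` \<C>) (f ` C) \<longleftrightarrow> min_member \<C> C"
proof -
  have eq: "f ` D = f ` C \<longleftrightarrow> D = C" if "D \<in> \<C>" for D
    using inj_on_image_eq_iff[OF inj sub[OF that] C] .
  have le: "f ` D \<subseteq> f ` C \<longleftrightarrow> D \<subseteq> C" if "D \<in> \<C>" for D
  proof
    assume "f ` D \<subseteq> f ` C"
    then show "D \<subseteq> C" using inj sub[OF that] C by (fastforce dest: inj_onD)
  qed blast
  have "f ` C \<in> (`) f ` \<C> \<longleftrightarrow> C \<in> \<C>"
  proof
    assume "f ` C \<in> (`) f ` \<C>"
    then obtain D where "D \<in> \<C>" "f ` C = f ` D" by (rule imageE) simp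
    then show "C \<in> \<C>" using eq[of D] by simp
  qed simp
  moreover have "(\<forall>D\<in>(`) f ` \<C>. D \<subseteq> f ` C \<longrightarrow> D = {} \<or> D = f ` C) \<longleftrightarrow>
      (\<forall>D\<in>\<C>. D \<subseteq> C \<longrightarrow> D = {} \<or> D = C)"
    by (simp add: eq le)
  ultimately show ?thesis unfolding min_member_def by simp
qed

text \<open>The members of the family have vectors as elements, whereas cycles are sets of elements
  of \<open>M\<close>. Along an injective labelling by vectors, complementarity may be tested on the
  labels' side or on the elements' side.\<close>

lemma hyperplane_complementary_image:
  assumes E: "finite E" "f ` E \<subseteq> gf2_space n" and inj: "inj_on f E"
  shows "hyperplane_complementary (vector_matroid (f ` E) (\<lambda>v. v)) \<longleftrightarrow>
    (\<forall>K. min_member (supports n E f) K \<longrightarrow> min_member (supports n E f) (E - K))"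
proof -
  interpret cycle_space E "supports n E f" using E by (intro cycle_space_supports)
  have fin: "finite (f ` E)" "(\<lambda>v. v) ` f ` E \<subseteq> gf2_space n" using E by auto
  have mm: "min_member (supports n (f ` E) (\<lambda>v. v)) (f ` K) \<longleftrightarrow> min_member (supports n E f) K"
    if "K \<subseteq> E" for K
    using min_member_image[OF inj sub_E that] by (simp add: supports_image)
  have diff: "f ` E - f ` K = f ` (E - K)" if "K \<subseteq> E" for K
    using inj_on_image_set_diff[OF inj] that by blast
  show ?thesis
    unfolding hyperplane_complementary_vector_matroid[OF fin]
  proof (intro iffI allI impI)
    fix K assume a: "\<forall>K. min_member (supports n (f ` E) (\<lambda>v. v)) K \<longrightarrow>
        min_member (supports n (f ` E) (\<lambda>v. v)) (f ` E - K)"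
      and K: "min_member (supports n E f) K"
    show "min_member (supports n E f) (E - K)"
      using a mm[of K] mm[of "E - K"] K diff min_member_sub[OF K] by auto
  next
    fix L assume a: "\<forall>K. min_member (supports n E f) K \<longrightarrow> min_member (supports n E f) (E - K)"
      and L: "min_member (supports n (f ` E) (\<lambda>v. v)) L"
    obtain K where K: "K \<in> supports n E f" "L = f ` K"
      using min_member_mem[OF L] unfolding supports_image by blast
    show "min_member (supports n (f ` E) (\<lambda>v. v)) (f ` E - L)"
      using a mm[of K] mm[of "E - K"] K L diff sub_E[OF K(1)] by auto
  qed
qed

lemma rank_vector_matroid:
  assumes "finite E" "f ` E \<subseteq> gf2_space n"
  shows "rank (vector_matroid E f) E \<le> n"
    and "rank (vector_matroid E f) E = n \<longleftrightarrow> gf2_space n \<subseteq> gf2.span (f ` E)"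
proof -
  interpret matroid "vector_matroid E f" using assms by (intro matroid_vector_matroid)
  obtain B where B: "basis (vector_matroid E f) B" using indep_in_basis[OF empty_indep] by blast
  then have B': "B \<subseteq> E" "inj_on f B" "gf2.independent (f ` B)" "f ` E \<subseteq> gf2.span (f ` B)"
    unfolding basis_vector_matroid by blast+
  have r: "rank (vector_matroid E f) E = card (f ` B)"
    using rank_ground[OF B] B' by (simp add: card_image)
  have sub: "f ` B \<subseteq> gf2_space n" using B' assms by blast
  show "rank (vector_matroid E f) E \<le> n" using r card_independent_le[OF B'(3) sub] by simp
  show "rank (vector_matroid E f) E = n \<longleftrightarrow> gf2_space n \<subseteq> gf2.span (f ` E)"
  proof
    assume "rank (vector_matroid E f) E = n"
    then have "gf2_space n \<subseteq> gf2.span (f ` B)" using independent_spanning[OF B'(3) sub] r by simp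
    then show "gf2_space n \<subseteq> gf2.span (f ` E)" using gf2.span_mono[of "f ` B" "f ` E"] B' by blast
  next
    assume "gf2_space n \<subseteq> gf2.span (f ` E)"
    also have "\<dots> \<subseteq> gf2.span (f ` B)" using B'(4) by (simp add: gf2.span_minimal)
    finally have "gf2.dim (gf2_space n) = card (f ` B)"
      using gf2.dim_unique[OF sub _ B'(3) refl] by blast
    then show "rank (vector_matroid E f) E = n" using r dim_gf2_space by simp
  qed
qed

text \<open>The rows of the representing matrix are the fundamental cycles of a basis, so its columns outside
  the basis are the unit vectors.\<close>

lemma binary_dual_representation:
  assumes fin: "finite (ground M)" and bin: "binary M"
  obtains n f where "f ` ground M \<subseteq> gf2_space n" "gf2_space n \<subseteq> gf2.span (f ` ground M)"
    "dual M = vector_matroid (ground M) f" "M = cycle_matroid (ground M) (supports n (ground M) f)"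
proof -
  define E where "E = ground M"
  obtain \<phi> where M: "M = vector_matroid E \<phi>" using bin unfolding binary_def E_def by blast
  have finE: "finite E" using fin by (simp add: E_def)
  define \<C> where "\<C> = {J. J \<subseteq> E \<and> sum \<phi> J = 0}"
  have M': "M = cycle_matroid E \<C>"
    unfolding M \<C>_def by (rule vector_matroid_eq_cycle_matroid[OF finE])
  interpret matroid M unfolding M by (rule matroid_vector_matroid[OF finE])
  obtain B where B: "basis M B" using indep_in_basis[OF empty_indep] by blast
  have BE: "B \<subseteq> E" using basis_sub[OF B] by (simp add: E_def)
  have B_indep: "C = {}" if "C \<in> \<C>" "C \<subseteq> B" for C
    using B that unfolding basis_def M' cycle_matroid_def by auto
  have "\<exists>C\<in>\<C>. C - B = {x}" if x: "x \<in> E - B" for x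
  proof -
    have "insert x B \<notin> indep M" using B x unfolding basis_def by blast
    then obtain C where C: "C \<in> \<C>" "C \<subseteq> insert x B" "C \<noteq> {}"
      using x BE unfolding M' cycle_matroid_def by auto
    then have "x \<in> C" using B_indep by blast
    then show ?thesis using C x by blast
  qed
  then obtain c where c: "\<And>x. x \<in> E - B \<Longrightarrow> c x \<in> \<C> \<and> c x - B = {x}" by metis
  define n where "n = card (E - B)"
  obtain h where h: "bij_betw h {..<n} (E - B)"
    using ex_bij_betw_nat_finite[of "E - B"] finE n_def by (auto simp: atLeast0LessThan)
  have hE: "h i \<in> E - B" if "i < n" for i using h that unfolding bij_betw_def by blast
  have ch: "c (h i) \<in> \<C>" "c (h i) - B = {h i}" if "i < n" for i using c[OF hE[OF that]] by blast+
  \<comment> \<open>Row \<open>i\<close> is the incidence vector of the fundamental cycle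
    \<open>c (h i)\<close>; the column at \<open>x\<close> is read off from it.\<close>
  define f :: "'a \<Rightarrow> nat \<Rightarrow> bit" where "f = (\<lambda>x i. if i < n \<and> x \<in> c (h i) then 1 else 0)"
  have f_space: "f ` E \<subseteq> gf2_space n" by (auto simp: f_def gf2_space_def)
  have fh: "f (h j) = unit_vec j" if j: "j < n" for j
  proof
    fix i
    have "h j \<in> c (h i) \<longleftrightarrow> i = j" if i: "i < n"
    proof -
      have "h j \<in> c (h i) \<longleftrightarrow> h j = h i" using ch(2)[OF i] hE[OF j] by blast
      also have "\<dots> \<longleftrightarrow> i = j" using h i j unfolding bij_betw_def by (auto dest: inj_onD)
      finally show ?thesis .
    qed
    then show "f (h j) i = unit_vec j i" using j by (auto simp: f_def unit_vec_def)
  qed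
  have span: "gf2_space n \<subseteq> gf2.span (f ` E)"
  proof (rule gf2_space_subset_span)
    fix i assume "i < n"
    then show "unit_vec i \<in> gf2.span (f ` E)" using fh[of i] hE[of i] by (metis DiffD1 gf2.span_base imageI)
  qed
  \<comment> \<open>Each fundamental cycle is orthogonal to the rows of the given matrix, and so is
    every combination of them.\<close>
  have supp_mem: "{x\<in>E. dot n a (f x) = 1} \<in> \<C>" for a
  proof -
    have "sum \<phi> {x\<in>E. dot n a (f x) = 1} j = 0" for j
    proof -
      have zero: "(\<Sum>x\<in>E. f x i * \<phi> x j) = 0" if i: "i < n" for i
      proof -
        have "(\<Sum>x\<in>E. f x i * \<phi> x j) = (\<Sum>x\<in>E. gf2_scale (f x i) (\<phi> x)) j"
          unfolding sum_fun_apply gf2_scale_def by (rule refl)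
        also have "(\<Sum>x\<in>E. gf2_scale (f x i) (\<phi> x)) = sum \<phi> {x\<in>E. f x i = 1}"
          by (rule sum_gf2_scale[OF finE])
        also have "{x\<in>E. f x i = 1} = c (h i)"
          using i ch(1)[OF i] by (auto simp: f_def \<C>_def)
        also have "sum \<phi> (c (h i)) = 0" using ch(1)[OF i] by (simp add: \<C>_def)
        finally show ?thesis by simp
      qed
      have "sum \<phi> {x\<in>E. dot n a (f x) = 1} j = (\<Sum>x\<in>E. gf2_scale (dot n a (f x)) (\<phi> x)) j"
        using sum_gf2_scale[OF finE, of "\<lambda>x. dot n a (f x)" \<phi>] by metis
      also have "\<dots> = (\<Sum>x\<in>E. \<Sum>i<n. a i * (f x i * \<phi> x j))"
        by (simp only: sum_fun_apply gf2_scale_def dot_def sum_distrib_right mult.assoc)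
      also have "\<dots> = (\<Sum>i<n. a i * (\<Sum>x\<in>E. f x i * \<phi> x j))"
        by (subst sum.swap) (simp only: sum_distrib_left)
      also have "\<dots> = (\<Sum>i<n. a i * 0)"
        by (intro sum.cong refl) (simp only: zero lessThan_iff)
      finally show ?thesis by simp
    qed
    then show ?thesis unfolding \<C>_def by (auto simp: fun_eq_iff)
  qed
  have mem_supp: "C \<in> supports n E f" if C: "C \<in> \<C>" for C
  proof -
    \<comment> \<open>The combination takes the fundamental cycles of those elements outside
      \<open>B\<close> that lie in \<open>C\<close>. It agrees with \<open>C\<close> outside
      \<open>B\<close>, so the difference is a cycle inside the basis and hence empty.\<close>
    define a :: "nat \<Rightarrow> bit" where "a = (\<lambda>i. if h i \<in> C then 1 else 0)"
    let ?S = "{x\<in>E. dot n a (f x) = 1}"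
    have "x \<in> ?S \<longleftrightarrow> x \<in> C" if x: "x \<in> E - B" for x
    proof -
      obtain j where j: "j < n" "x = h j" using h x unfolding bij_betw_def by blast
      have "dot n a (f x) = a j" using fh j dot_unit_vec by simp
      then show ?thesis using j x by (auto simp: a_def)
    qed
    moreover have CE: "C \<subseteq> E" using C by (simp add: \<C>_def)
    ultimately have sub: "sym_diff ?S C \<subseteq> B" by blast
    have "sum \<phi> (sym_diff ?S C) = sum \<phi> ?S + sum \<phi> C"
    proof -
      have fin: "finite ?S" "finite C" using finE CE finite_subset by auto
      have "sum \<phi> ?S + sum \<phi> C = (sum \<phi> (?S - C) + sum \<phi> (?S \<inter> C)) + (sum \<phi> (C - ?S) + sum \<phi> (C \<inter> ?S))"
        using sum.Int_Diff[OF fin(1), of \<phi> C] sum.Int_Diff[OF fin(2), of \<phi> ?S] by (simp only: add.commute)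
      also have "\<dots> = sum \<phi> (?S - C) + sum \<phi> (C - ?S) + (sum \<phi> (?S \<inter> C) + sum \<phi> (?S \<inter> C))"
        by (simp only: Int_commute add.assoc add.left_commute add.commute)
      also have "\<dots> = sum \<phi> (sym_diff ?S C)"
        using fin by (subst sum.union_disjoint) auto
      finally show ?thesis by simp
    qed
    then have "sym_diff ?S C \<in> \<C>" using C supp_mem[of a] CE unfolding \<C>_def by auto
    then have "sym_diff ?S C = {}" using B_indep sub by blast
    then have "C = ?S" by blast
    then show ?thesis using supportsI by metis
  qed
  have "supports n E f = \<C>" using supp_mem mem_supp unfolding supports_def by auto
  then have M2: "M = cycle_matroid E (supports n E f)" using M' by simp
  then have "M = dual (vector_matroid E f)" using dual_vector_matroid[OF f_space] by simp
  then have "dual M = vector_matroid E f"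
    using matroid.dual_dual[OF matroid_vector_matroid[OF finE]] by metis
  then show thesis using that f_space span M2 unfolding E_def by blast
qed

section \<open>Series minors of binary matroids\<close>

lemma (in cycle_space) circuit_difference_cycle_matroid:
  "circuit_difference (cycle_matroid E \<C>) \<longleftrightarrow>
    (\<forall>C D. min_member \<C> C \<longrightarrow> min_member \<C> D \<longrightarrow> C \<noteq> D \<longrightarrow> C \<inter> D \<noteq> {} \<longrightarrow>
      min_member \<C> (sym_diff C D))"
  unfolding circuit_difference_def using circuit_cycle_matroid[of \<C> E, OF sub_E] by simp

lemma (in cycle_space) cycle_space_contract: "cycle_space (E - X) ((\<lambda>C. C - X) ` \<C>)"
proof
  show "{} \<in> (\<lambda>C. C - X) ` \<C>" using empty_mem by force
  fix C D assume "C \<in> (\<lambda>C. C - X) ` \<C>" "D \<in> (\<lambda>C. C - X) ` \<C>"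
  then obtain C' D' where "C' \<in> \<C>" "D' \<in> \<C>" "C = C' - X" "D = D' - X" by blast
  moreover have "sym_diff (C' - X) (D' - X) = sym_diff C' D' - X" by blast
  ultimately show "sym_diff C D \<in> (\<lambda>C. C - X) ` \<C>"
    using imageI[OF sym_diff_mem[of C' D'], of "\<lambda>C. C - X"] by metis
qed (use finite_E sub_E in auto)

text \<open>Since \<open>y\<close> records whether \<open>x\<close> was in a cycle, removing
  \<open>x\<close> preserves and reflects inclusion, equality, emptiness and disjointness of
  cycles.\<close>

lemma (in cycle_space) circuit_difference_series_contract:
  assumes series: "\<And>C. C \<in> \<C> \<Longrightarrow> x \<in> C \<longleftrightarrow> y \<in> C" and "x \<noteq> y"
  shows "circuit_difference (cycle_matroid (E - {x}) ((\<lambda>C. C - {x}) ` \<C>)) \<longleftrightarrow>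
    circuit_difference (cycle_matroid E \<C>)"
proof -
  let ?c = "\<lambda>C. C - {x}"
  interpret contr: cycle_space "E - {x}" "?c ` \<C>" by (rule cycle_space_contract)
  have le: "?c C \<subseteq> ?c D \<longleftrightarrow> C \<subseteq> D" if "C \<in> \<C>" "D \<in> \<C>" for C D
    using series[OF that(1)] series[OF that(2)] \<open>x \<noteq> y\<close> by blast
  have eq: "?c C = ?c D \<longleftrightarrow> C = D" if "C \<in> \<C>" "D \<in> \<C>" for C D
    using le[OF that] le[OF that(2,1)] by blast
  have empty: "?c C = {} \<longleftrightarrow> C = {}" if "C \<in> \<C>" for C
    using series[OF that] \<open>x \<noteq> y\<close> by blast
  have mm: "min_member (?c ` \<C>) (?c C) \<longleftrightarrow> min_member \<C> C" if C: "C \<in> \<C>" for C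
  proof -
    have q: "(\<forall>D\<in>?c ` \<C>. D \<subseteq> ?c C \<longrightarrow> D = {} \<or> D = ?c C) \<longleftrightarrow> (\<forall>D\<in>\<C>. D \<subseteq> C \<longrightarrow> D = {} \<or> D = C)"
      unfolding ball_simps(9) using C le eq empty by (intro ball_cong refl) metis
    then show ?thesis
      unfolding min_member_def q by (simp only: C imageI[OF C, of ?c] empty[OF C])
  qed
  have sd: "sym_diff (?c C) (?c D) = ?c (sym_diff C D)" for C D by blast
  have mm_sd: "min_member (?c ` \<C>) (sym_diff (?c C) (?c D)) \<longleftrightarrow> min_member \<C> (sym_diff C D)"
    if "C \<in> \<C>" "D \<in> \<C>" for C D
    unfolding sd by (rule mm[OF sym_diff_mem[OF that]])
  have int: "?c C \<inter> ?c D = {} \<longleftrightarrow> C \<inter> D = {}" if "C \<in> \<C>" "D \<in> \<C>" for C D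
    using series[OF that(1)] series[OF that(2)] \<open>x \<noteq> y\<close> by blast
  have "(\<forall>C D. min_member (?c ` \<C>) C \<longrightarrow> min_member (?c ` \<C>) D \<longrightarrow> C \<noteq> D \<longrightarrow> C \<inter> D \<noteq> {} \<longrightarrow>
          min_member (?c ` \<C>) (sym_diff C D)) \<longleftrightarrow>
        (\<forall>C\<in>\<C>. \<forall>D\<in>\<C>. min_member (?c ` \<C>) (?c C) \<longrightarrow> min_member (?c ` \<C>) (?c D) \<longrightarrow> ?c C \<noteq> ?c D \<longrightarrow>
          ?c C \<inter> ?c D \<noteq> {} \<longrightarrow> min_member (?c ` \<C>) (sym_diff (?c C) (?c D)))"
    using min_member_mem[of "?c ` \<C>"] by (smt (verit) image_iff)
  also have "\<dots> \<longleftrightarrow> (\<forall>C\<in>\<C>. \<forall>D\<in>\<C>. min_member \<C> C \<longrightarrow> min_member \<C> D \<longrightarrow> C \<noteq> D \<longrightarrow> C \<inter> D \<noteq> {} \<longrightarrow>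
          min_member \<C> (sym_diff C D))"
    by (intro ball_cong refl) (simp only: mm mm_sd eq int)
  also have "\<dots> \<longleftrightarrow> (\<forall>C D. min_member \<C> C \<longrightarrow> min_member \<C> D \<longrightarrow> C \<noteq> D \<longrightarrow> C \<inter> D \<noteq> {} \<longrightarrow>
          min_member \<C> (sym_diff C D))"
    using min_member_mem[of \<C>] by meson
  finally show ?thesis
    unfolding circuit_difference_cycle_matroid contr.circuit_difference_cycle_matroid .
qed

lemma circuit_delete: "circuit (delete M X) C \<longleftrightarrow> circuit M C \<and> C \<inter> X = {}"
  unfolding circuit_def delete_def by auto

lemma circuit_difference_delete: "circuit_difference M \<Longrightarrow> circuit_difference (delete M X)"
  unfolding circuit_difference_def circuit_delete by blast

lemma binary_delete: "binary M \<Longrightarrow> binary (delete M X)"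
  unfolding binary_def by (metis Diff_subset delete_vector_matroid ground_delete ground_vector_matroid image_mono order_trans)

lemma binary_dual: "finite (ground M) \<Longrightarrow> binary M \<Longrightarrow> binary (dual M)"
  by (rule binary_dual_representation[of M]) (auto simp: binary_def)

lemma ground_contract [simp]: "ground (contract M X) = ground M - X"
  by (simp add: contract_def)

lemma binary_contract: "finite (ground M) \<Longrightarrow> binary M \<Longrightarrow> binary (contract M X)"
  unfolding contract_def by (intro binary_dual binary_delete) auto

lemma supports_diff: "supports n (E - X) f = (\<lambda>C. C - X) ` supports n E f"
  unfolding supports_def by (auto simp: image_image intro!: image_cong)

lemma contract_eq_cycle_matroid:
  assumes "dual M = vector_matroid E f" "f ` E \<subseteq> gf2_space n"
  shows "contract M X = cycle_matroid (E - X) ((\<lambda>C. C - X) ` supports n E f)"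
  unfolding contract_def assms(1) delete_vector_matroid supports_diff[symmetric]
  using assms(2) by (intro dual_vector_matroid) blast

lemma dot_commute: "dot n a b = dot n b a"
  by (simp only: dot_def mult.commute)

lemma gf2_eq_iff_dot:
  assumes "v \<in> gf2_space n" "w \<in> gf2_space n"
  shows "v = w \<longleftrightarrow> (\<forall>a. dot n a v = 1 \<longleftrightarrow> dot n a w = 1)"
proof
  assume a: "\<forall>a. dot n a v = 1 \<longleftrightarrow> dot n a w = 1"
  show "v = w"
  proof
    fix i
    show "v i = w i"
    proof (cases "i < n")
      case True
      have "v i = 1 \<longleftrightarrow> w i = 1"
        using a dot_unit_vec[OF True] dot_commute[of n "unit_vec i"] by metis
      then show ?thesis using bit_neq_iff by metis
    next
      case False
      then show ?thesis using assms by (simp add: gf2_space_def)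
    qed
  qed
qed simp

text \<open>Series pairs are parallel pairs of the dual: the two columns sum to zero, and minimality
  excludes a zero column.\<close>

lemma cocircuit_pair:
  assumes "finite E" "dual M = vector_matroid E f" "x \<noteq> y"
  shows "cocircuit M {x, y} \<longleftrightarrow> x \<in> E \<and> y \<in> E \<and> f x = f y \<and> f x \<noteq> 0"
proof -
  have add0: "v + w = 0 \<longleftrightarrow> v = w" for v w :: "nat \<Rightarrow> bit"
  proof
    assume "v + w = 0"
    moreover have "v = (v + w) + w" by (simp only: add.assoc gf2_add_self add_0_right)
    ultimately show "v = w" by (simp only: add_0_left)
  qed simp
  let ?Z = "{J. J \<subseteq> E \<and> sum f J = 0}"
  have "cocircuit M {x, y} \<longleftrightarrow> min_member ?Z {x, y}"
    unfolding cocircuit_def assms(2) vector_matroid_eq_cycle_matroid[OF assms(1)]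
    by (rule circuit_cycle_matroid) blast
  also have "\<dots> \<longleftrightarrow> x \<in> E \<and> y \<in> E \<and> f x = f y \<and> f x \<noteq> 0"
  proof
    assume m: "min_member ?Z {x, y}"
    have "{x, y} \<in> ?Z" using m by (rule min_member_mem)
    then have "x \<in> E" "y \<in> E" "f x + f y = 0" using assms(3) by auto
    moreover have "f x \<noteq> 0"
      using min_memberD[OF m, of "{x}"] assms(3) \<open>x \<in> E\<close> by auto
    ultimately show "x \<in> E \<and> y \<in> E \<and> f x = f y \<and> f x \<noteq> 0" using add0 by metis
  next
    assume a: "x \<in> E \<and> y \<in> E \<and> f x = f y \<and> f x \<noteq> 0"
    have "D = {} \<or> D = {x, y}" if "D \<in> ?Z" "D \<subseteq> {x, y}" for D
    proof -
      have "D \<in> Pow {x, y}" using that by blast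
      then have "D = {} \<or> D = {x} \<or> D = {y} \<or> D = {x, y}" by (auto simp: Pow_insert)
      moreover have "sum f {x} \<noteq> 0" "sum f {y} \<noteq> 0" using a by auto
      then have "D \<noteq> {x}" "D \<noteq> {y}" using that(1) by (metis (mono_tags) mem_Collect_eq)+
      ultimately show ?thesis by blast
    qed
    moreover have "{x, y} \<in> ?Z" using a assms(3) by simp
    ultimately show "min_member ?Z {x, y}" unfolding min_member_def by blast
  qed
  finally show ?thesis .
qed

text \<open>One direction makes the class closed under series contraction; the other shows that a
  series contraction never repairs a failure, so a minimal failure has no series pair.\<close>

lemma circuit_difference_contract:
  assumes fin: "finite (ground M)" and bin: "binary M" and ef: "cocircuit M {e, e'}" "e' \<noteq> e"
  shows "circuit_difference (contract M {e}) \<longleftrightarrow> circuit_difference M"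
proof -
  obtain n f where f: "f ` ground M \<subseteq> gf2_space n" "dual M = vector_matroid (ground M) f"
    "M = cycle_matroid (ground M) (supports n (ground M) f)"
    by (rule binary_dual_representation[OF fin bin])
  interpret cycle_space "ground M" "supports n (ground M) f"
    using fin by (rule cycle_space_supports)
  have "e \<in> ground M" "e' \<in> ground M" "f e = f e'"
    using ef cocircuit_pair[OF fin f(2), of e e'] by auto
  then have "e \<in> C \<longleftrightarrow> e' \<in> C" if "C \<in> supports n (ground M) f" for C
    using that unfolding supports_def by auto
  then have "circuit_difference (contract M {e}) \<longleftrightarrow>
      circuit_difference (cycle_matroid (ground M) (supports n (ground M) f))"
    unfolding contract_eq_cycle_matroid[OF f(2,1)] using ef(2)
    by (intro circuit_difference_series_contract) auto
  then show ?thesis using f(3) by simp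
qed

lemma circuit_difference_series_minor:
  assumes "series_minor N M" "finite (ground M)" "binary M" "circuit_difference M"
  shows "circuit_difference N"
proof -
  have "series_minor_step\<^sup>*\<^sup>* M N" using assms(1) unfolding series_minor_def .
  \<comment> \<open>Finiteness and binarity are carried along because each contraction step requires
    them.\<close>
  then have "finite (ground N) \<and> binary N \<and> circuit_difference N"
  proof (induction rule: rtranclp_induct)
    case (step K L)
    consider e where "L = delete K {e}"
      | e e' where "e' \<noteq> e" "cocircuit K {e, e'}" "L = contract K {e}"
      using step.hyps(2) unfolding series_minor_step_def by blast
    then show ?case
    proof cases
      case 1
      then show ?thesis using step.IH circuit_difference_delete binary_delete by auto
    next
      case 2
      then show ?thesis using step.IH circuit_difference_contract[of K e e'] binary_contract by auto
    qed
  qed (use assms in blast)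
  then show ?thesis by blast
qed

text \<open>The property passes to series minors, so only the first step of a sequence matters.
  Without series pairs this step is a deletion.\<close>

lemma excluded_series_minor_iff:
  assumes M: "matroid M" and bin: "binary M"
  shows "excluded_series_minor circuit_difference M \<longleftrightarrow>
    \<not> circuit_difference M \<and> (\<forall>e\<in>ground M. circuit_difference (delete M {e})) \<and>
    (\<forall>e e'. e \<noteq> e' \<longrightarrow> \<not> cocircuit M {e, e'})" (is "?L \<longleftrightarrow> ?R")
proof
  have fin: "finite (ground M)" using M by (simp add: matroid_def)
  {
    assume L: ?L
    then have nd: "\<not> circuit_difference M"
      and minors: "\<And>N. series_minor_step M N \<Longrightarrow> N \<noteq> M \<Longrightarrow> circuit_difference N"
      unfolding excluded_series_minor_def series_minor_def by blast+
    have "circuit_difference (delete M {e})" if "e \<in> ground M" for e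
    proof (rule minors)
      show "series_minor_step M (delete M {e})" unfolding series_minor_step_def using that by blast
      have "ground (delete M {e}) \<noteq> ground M" using that by auto
      then show "delete M {e} \<noteq> M" by metis
    qed
    moreover have "\<not> cocircuit M {e, e'}" if "e \<noteq> e'" for e e'
    proof
      assume c: "cocircuit M {e, e'}"
      then have "ground (contract M {e}) \<noteq> ground M"
        unfolding cocircuit_def circuit_def by auto
      then have "contract M {e} \<noteq> M" by metis
      moreover have "series_minor_step M (contract M {e})"
        unfolding series_minor_step_def using c that by (intro disjI2 exI[of _ e] exI[of _ e']) simp
      ultimately have "circuit_difference (contract M {e})" using minors by blast
      then show False using circuit_difference_contract[OF fin bin c] that nd by simp
    qed
    ultimately show ?R using nd by blast
  next
    assume R: ?R
    have "circuit_difference N" if N: "series_minor N M" "N \<noteq> M" for N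
    proof -
      obtain K where K: "series_minor_step M K" "series_minor N K"
        using N unfolding series_minor_def by (metis converse_rtranclpE)
      then obtain e where e: "e \<in> ground M" "K = delete M {e}"
        using R unfolding series_minor_step_def by metis
      show ?thesis
        by (rule circuit_difference_series_minor[OF K(2)])
          (use e R fin binary_delete[OF bin] in auto)
    qed
    then show ?L using R M unfolding excluded_series_minor_def by blast
  }
qed

text \<open>Let \<open>K\<close> be a circuit of the contraction inside \<open>D - {t}\<close>. The
  complement of \<open>D - {t}\<close> is a nonempty cycle inside the complement of
  \<open>K\<close>, which is a circuit, so the two agree and \<open>D - {t}\<close> equals
  \<open>K\<close>.\<close>

lemma (in cycle_space) min_member_if_contract_complementary:
  assumes comp: "\<And>K. min_member ((\<lambda>C. C - {t}) ` \<C>) K \<Longrightarrow>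
      min_member ((\<lambda>C. C - {t}) ` \<C>) (E - {t} - K)"
    and mem: "E - {t} \<in> \<C>" and not_mem: "{t} \<notin> \<C>" and t: "t \<in> E"
    and D: "D \<in> \<C>" "D \<noteq> {}" "D \<noteq> E - {t}"
  shows "min_member \<C> D"
proof -
  let ?c = "\<lambda>C. C - {t}"
  interpret contr: cycle_space "E - {t}" "?c ` \<C>" by (rule cycle_space_contract)
  have DE: "D \<subseteq> E" using D sub_E by blast
  \<comment> \<open>Removing \<open>t\<close> is injective on cycles because \<open>{t}\<close> is
    not a cycle; this carries minimality in the contraction back to \<open>D\<close>.\<close>
  have tip_eq: "C = C'" if "C \<in> \<C>" "C' \<in> \<C>" "?c C = ?c C'" for C C'
  proof (rule ccontr)
    assume "C \<noteq> C'"
    then have "sym_diff C C' = {t}" using that(3) by blast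
    then show False using sym_diff_mem[OF that(1,2)] not_mem by metis
  qed
  have "?c D \<noteq> {}" using tip_eq[OF D(1) empty_mem] D(2) by auto
  then obtain x where "x \<in> ?c D" by blast
  then obtain K where K: "min_member (?c ` \<C>) K" "K \<subseteq> ?c D"
    using contr.min_member_through[OF imageI[OF D(1)]] by blast
  have "?c D \<noteq> E - {t}" using tip_eq[OF D(1) mem] D(3) by auto
  then have ne: "E - {t} - ?c D \<noteq> {}" using DE by blast
  have "?c (sym_diff (E - {t}) D) = E - {t} - ?c D" using DE by blast
  then have "E - {t} - ?c D \<in> ?c ` \<C>"
    using imageI[OF sym_diff_mem[OF mem D(1)], of ?c] by metis
  then have "E - {t} - ?c D = E - {t} - K"
    using min_memberD[OF comp[OF K(1)]] ne K(2) by blast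
  then have Keq: "K = ?c D" using K(2) DE by blast
  have "D' = {} \<or> D' = D" if D': "D' \<in> \<C>" "D' \<subseteq> D" for D'
  proof (cases "?c D' = {}")
    case True
    then show ?thesis using tip_eq[OF D'(1) empty_mem] by auto
  next
    case False
    then have "?c D' = ?c D" using min_memberD[OF K(1) imageI[OF D'(1)]] Keq D'(2) by blast
    then show ?thesis using tip_eq[OF D'(1) D(1)] by blast
  qed
  then show ?thesis using D unfolding min_member_def by blast
qed

section \<open>Projective geometries and the family of extended affine geometries\<close>

lemma finite_gf2_space: "finite (gf2_space n)"
proof (rule finite_subset)
  show "gf2_space n \<subseteq> (\<lambda>S i. if i \<in> S then 1 else 0) ` Pow {..<n}"
  proof
    fix v assume v: "v \<in> gf2_space n"
    have "v = (\<lambda>i. if i \<in> {i. i < n \<and> v i = 1} then 1 else 0)"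
    proof
      fix i show "v i = (if i \<in> {i. i < n \<and> v i = 1} then 1 else 0)"
        using v bit_neq_iff[of "v i"] by (cases "i < n") (auto simp: gf2_space_def)
    qed
    moreover have "{i. i < n \<and> v i = 1} \<in> Pow {..<n}" by auto
    ultimately show "v \<in> (\<lambda>S i. if i \<in> S then 1 else 0) ` Pow {..<n}" by (rule image_eqI)
  qed
qed simp

text \<open>On the whole space the support of any nonzero functional is minimal. The inequality on
  the right excludes the zero functional.\<close>

lemma hyperplane_PG:
  "hyperplane (PG n) H \<longleftrightarrow>
    (\<exists>a. H = {v \<in> gf2_space n - {0}. dot n a v = 0} \<and> H \<noteq> gf2_space n - {0})" (is "_ \<longleftrightarrow> ?R")
proof -
  let ?V = "gf2_space n - {0}"
  let ?S = "\<lambda>a. {v \<in> ?V. dot n a v = 1}"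
  have h: "hyperplane (PG n) H \<longleftrightarrow> H \<subseteq> ?V \<and> min_member (supports n ?V (\<lambda>v. v)) (?V - H)"
    unfolding PG_def using finite_gf2_space by (intro hyperplane_vector_matroid) auto
  have compl: "?V - {v \<in> ?V. dot n a v = 0} = ?S a" for a
    using bit_neq_iff by blast
  have compl': "?V - ?S a = {v \<in> ?V. dot n a v = 0}" for a
    using bit_neq_iff by blast
  show ?thesis unfolding h
  proof
    assume l: "H \<subseteq> ?V \<and> min_member (supports n ?V (\<lambda>v. v)) (?V - H)"
    then obtain a where a: "?V - H = ?S a"
      using min_member_mem unfolding supports_def by blast
    have "H = ?V - (?V - H)" using l by blast
    then have "H = {v \<in> ?V. dot n a v = 0}" using a compl'[of a] by simp
    moreover have "H \<noteq> ?V" using l min_member_nonempty by blast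
    ultimately show ?R by blast
  next
    assume ?R
    then obtain a where a: "H = {v \<in> ?V. dot n a v = 0}" "H \<noteq> ?V" by blast
    have S: "?V - H = ?S a" using a(1) compl by simp
    have "?S b = {} \<or> ?S b = ?S a" if b: "?S b \<subseteq> ?S a" for b
    proof (rule ccontr)
      assume "\<not> ?thesis"
      then obtain v w where v: "v \<in> ?V" "dot n a v = 1" "dot n b v = 0"
        and w: "w \<in> ?V" "dot n b w = 1" using b bit_neq_iff by blast
      have "dot n a w = 1" using w b by blast
      \<comment> \<open>The sum of a point where only \<open>a\<close> is one and a point where both
        are one lies in the support of \<open>b\<close> but not of \<open>a\<close>.\<close>
      then have "dot n a (v + w) = 0" "dot n b (v + w) = 1"
        using v w by (simp_all add: dot_add_right)
      moreover have "v + w \<in> gf2_space n"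
        using v w subspace_gf2_space gf2.subspace_add by blast
      moreover have "v + w \<noteq> 0" using \<open>dot n b (v + w) = 1\<close> by force
      ultimately have "v + w \<in> ?S b" "v + w \<notin> ?S a" by simp_all
      then show False using b by blast
    qed
    then have "min_member (supports n ?V (\<lambda>v. v)) (?V - H)"
      unfolding min_member_def using a S supportsI[of ?V n a "\<lambda>v. v"]
      by (auto simp: supports_def)
    then show "H \<subseteq> ?V \<and> min_member (supports n ?V (\<lambda>v. v)) (?V - H)" using a(1) by blast
  qed
qed

lemma isomorphic_vector_matroid:
  assumes "inj_on f E"
  shows "isomorphic (vector_matroid E f) (vector_matroid (f ` E) (\<lambda>v. v))"
  unfolding isomorphic_def
proof (intro exI conjI allI impI)
  show "bij_betw f (ground (vector_matroid E f)) (ground (vector_matroid (f ` E) (\<lambda>v. v)))"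
    using assms by (simp add: bij_betw_def)
  fix I assume I: "I \<subseteq> ground (vector_matroid E f)"
  then have "inj_on f I" using assms inj_on_subset by auto
  then show "I \<in> indep (vector_matroid E f) \<longleftrightarrow> f ` I \<in> indep (vector_matroid (f ` E) (\<lambda>v. v))"
    using I by (auto simp: vector_matroid_def)
qed

text \<open>The isomorphism itself serves as the representation. The second hypothesis is there
  because \<open>isomorphic\<close> compares subsets of the ground set only.\<close>

lemma isomorphic_vector_matroidE:
  assumes "isomorphic M (vector_matroid S (\<lambda>v. v))" "\<And>I. I \<in> indep M \<Longrightarrow> I \<subseteq> ground M"
  obtains f where "bij_betw f (ground M) S" "M = vector_matroid (ground M) f"
proof -
  obtain f where f: "bij_betw f (ground M) S"
    "\<And>I. I \<subseteq> ground M \<Longrightarrow> I \<in> indep M \<longleftrightarrow> f ` I \<in> indep (vector_matroid S (\<lambda>v. v))"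
    using assms(1) unfolding isomorphic_def by auto
  have "I \<in> indep M \<longleftrightarrow> I \<in> indep (vector_matroid (ground M) f)" for I
  proof (cases "I \<subseteq> ground M")
    case True
    then have "inj_on f I" "f ` I \<subseteq> S" using f(1) inj_on_subset unfolding bij_betw_def by blast+
    then show ?thesis using f(2)[OF True] True by (simp add: vector_matroid_def)
  next
    case False
    then show ?thesis using assms(2) by (auto simp: vector_matroid_def)
  qed
  then have "M = vector_matroid (ground M) f"
    by (intro matroid.equality) auto
  then show thesis using that f(1) by blast
qed

text \<open>Coordinates for the family: \<open>a\<close> is a functional with the hyperplane as its
  kernel, and \<open>T\<close> consists of the affine points left by \<open>X\<close>. As
  \<open>T\<close> spans, adding \<open>e\<close> does not raise the rank, and the bound on the rank
  of \<open>N\<close> becomes a bound on \<open>n\<close>.\<close>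

lemma AG_plus_family_iff:
  "N \<in> AG_plus_family \<longleftrightarrow> (\<exists>n a e T.
    e \<in> gf2_space n - {0} \<and> dot n a e = 0 \<and> T \<subseteq> {v \<in> gf2_space n. dot n a v = 1} \<and>
    hyperplane_complementary (vector_matroid T (\<lambda>v. v)) \<and> gf2_space n \<subseteq> gf2.span T \<and> n \<ge> 3 \<and>
    N = vector_matroid (insert e T) (\<lambda>v. v))" (is "_ \<longleftrightarrow> ?R")
proof
  have AG: "AG n H = vector_matroid (gf2_space n - {0} - H) (\<lambda>v. v)"
    "AG_plus n H e = vector_matroid (gf2_space n - {0} - (H - {e})) (\<lambda>v. v)" for n H e
    unfolding AG_def AG_plus_def PG_def delete_vector_matroid by (rule refl)+
  {
    assume "N \<in> AG_plus_family"
    then obtain n H e X where H: "hyperplane (PG n) H" "e \<in> H" and X: "X \<subseteq> gf2_space n - {0} - H"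
      and hc: "hyperplane_complementary (delete (AG n H) X)"
      and r: "rank (delete (AG n H) X) (ground (delete (AG n H) X)) = n"
      and N: "N = delete (AG_plus n H e) X" "3 \<le> rank N (ground N)"
      unfolding AG_plus_family_def by (auto simp: AG)
    obtain a where a: "H = {v \<in> gf2_space n - {0}. dot n a v = 0}"
      using H(1) unfolding hyperplane_PG by blast
    let ?T = "gf2_space n - {0} - H - X"
    have T: "delete (AG n H) X = vector_matroid ?T (\<lambda>v. v)"
      unfolding AG delete_vector_matroid by (rule refl)
    have "gf2_space n - {0} - (H - {e}) - X = insert e ?T" using H X a by blast
    then have N': "N = vector_matroid (insert e ?T) (\<lambda>v. v)"
      unfolding N AG delete_vector_matroid by simp
    have fin: "finite ?T" "finite (insert e ?T)" using finite_gf2_space by auto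
    have sub: "(\<lambda>v. v) ` ?T \<subseteq> gf2_space n" "(\<lambda>v. v) ` insert e ?T \<subseteq> gf2_space n"
      using H a by auto
    have "gf2_space n \<subseteq> gf2.span ?T"
      using r rank_vector_matroid(2)[OF fin(1) sub(1)] unfolding T by simp
    moreover have "n \<ge> 3"
      using N(2) rank_vector_matroid(1)[OF fin(2) sub(2)] unfolding N' by simp
    moreover have "?T \<subseteq> {v \<in> gf2_space n. dot n a v = 1}" using a bit_neq_iff by blast
    moreover have "e \<in> gf2_space n - {0}" "dot n a e = 0" using H a by blast+
    ultimately show ?R using N' hc unfolding T by blast
  next
    assume ?R
    then obtain n a e T where e: "e \<in> gf2_space n - {0}" "dot n a e = 0"
      and T: "T \<subseteq> {v \<in> gf2_space n. dot n a v = 1}"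
      and hc: "hyperplane_complementary (vector_matroid T (\<lambda>v. v))"
      and span: "gf2_space n \<subseteq> gf2.span T" and n: "n \<ge> 3"
      and N: "N = vector_matroid (insert e T) (\<lambda>v. v)" by blast
    let ?V = "gf2_space n - {0}"
    let ?H = "{v \<in> ?V. dot n a v = 0}"
    let ?X = "?V - ?H - T"
    have TV: "T \<subseteq> ?V - ?H" using T by auto
    \<comment> \<open>A point of \<open>T\<close> lies off \<open>?H\<close> and so makes it a
      proper subset, as \<open>hyperplane_PG\<close> demands.\<close>
    have "T \<noteq> {}"
    proof
      assume "T = {}"
      then have "gf2_space n \<subseteq> {0}" using span by simp
      then have "unit_vec 0 = (0 :: nat \<Rightarrow> bit)" using n unit_vec_in_space[of 0 n] by auto
      then show False by (metis unit_vec_def zero_fun_apply zero_neq_one)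
    qed
    then have "?H \<noteq> ?V" using TV by blast
    then have H: "hyperplane (PG n) ?H" unfolding hyperplane_PG by blast
    have "?V - ?H - ?X = T" "?V - (?H - {e}) - ?X = insert e T" using TV e by blast+
    then have D: "delete (AG n ?H) ?X = vector_matroid T (\<lambda>v. v)" "N = delete (AG_plus n ?H e) ?X"
      unfolding AG delete_vector_matroid N by simp_all
    have fin: "finite T" "finite (insert e T)"
      using finite_subset[OF TV] finite_gf2_space by auto
    have sub: "(\<lambda>v. v) ` T \<subseteq> gf2_space n" "(\<lambda>v. v) ` insert e T \<subseteq> gf2_space n"
      using T e by auto
    have "rank (vector_matroid T (\<lambda>v. v)) T = n"
      using rank_vector_matroid(2)[OF fin(1) sub(1)] span by simp
    moreover have "gf2_space n \<subseteq> gf2.span (insert e T)"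
      using span gf2.span_mono[of T "insert e T"] by blast
    then have "rank N (ground N) = n"
      using rank_vector_matroid(2)[OF fin(2) sub(2)] unfolding N by simp
    moreover have "e \<in> ?H" using e by blast
    moreover have "?X \<subseteq> ground (AG n ?H)" unfolding AG by auto
    ultimately show "N \<in> AG_plus_family"
      unfolding AG_plus_family_def using H D(1) hc n
      by (intro CollectI exI[of _ n] exI[of _ ?H] exI[of _ e] exI[of _ ?X] conjI D(2)) simp_all
  }
qed

text \<open>Two vectors span at most a plane, so from dimension three on some \<open>u\<close> lies
  outside their span.\<close>

lemma ex_functional_separating:
  assumes n: "n \<ge> 3" and vw: "v \<in> gf2_space n" "w \<in> gf2_space n"
  obtains a u where "dot n a v = 0" "dot n a w = 0" "u \<in> gf2_space n" "dot n a u = 1"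
proof -
  have "\<not> gf2_space n \<subseteq> gf2.span {v, w}"
  proof
    assume "gf2_space n \<subseteq> gf2.span {v, w}"
    then have "gf2.dim (gf2_space n) \<le> card {v, w}" by (rule gf2.dim_le_card) simp
    then show False using n card_insert_le_m1[of 2 "{w}" v] by (simp add: dim_gf2_space)
  qed
  then obtain u where u: "u \<in> gf2_space n" "u \<notin> gf2.span {v, w}" by blast
  have "{v, w} \<subseteq> gf2_space n" using vw by blast
  then show thesis using separating_functional[OF u(1) _ u(2)] that u(1) by (metis insertCI)
qed

section \<open>The characterization\<close>

lemma excluded_series_minor_imp_family:
  fixes M :: "'a matroid"
  assumes M: "matroid M" and bin: "binary M"
    and exc: "excluded_series_minor circuit_difference M"
  shows "\<exists>N\<in>AG_plus_family. isomorphic (dual M) N"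
proof -
  define E where "E = ground M"
  have fin: "finite E" using M by (simp add: matroid_def E_def)
  have ncd: "\<not> circuit_difference M"
    and del: "\<And>e. e \<in> E \<Longrightarrow> circuit_difference (delete M {e})"
    and nco: "\<And>e e'. e \<noteq> e' \<Longrightarrow> \<not> cocircuit M {e, e'}"
    using exc unfolding excluded_series_minor_iff[OF M bin] E_def by blast+
  obtain n f where f_sub: "f ` E \<subseteq> gf2_space n" and span: "gf2_space n \<subseteq> gf2.span (f ` E)"
    and dual: "dual M = vector_matroid E f" and M_eq: "M = cycle_matroid E (supports n E f)"
    using binary_dual_representation[OF fin[unfolded E_def] bin] unfolding E_def by metis
  let ?C = "supports n E f"
  interpret cycle_space E ?C using fin by (rule cycle_space_supports)
  have circ: "circuit M C \<longleftrightarrow> min_member ?C C" for C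
    unfolding M_eq by (rule circuit_cycle_matroid[OF sub_E])
  obtain C1 C2 where C: "min_member ?C C1" "min_member ?C C2" "C1 \<noteq> C2" "C1 \<inter> C2 \<noteq> {}"
    "\<not> min_member ?C (sym_diff C1 C2)"
    using ncd unfolding circuit_difference_def circ by blast
  have good: "min_member ?C (sym_diff C D)"
    if "min_member ?C C" "min_member ?C D" "C \<noteq> D" "C \<inter> D \<noteq> {}" "x \<in> E" "x \<notin> C" "x \<notin> D" for C D x
    using del[OF \<open>x \<in> E\<close>] that unfolding circuit_difference_def circuit_delete circ by blast
  \<comment> \<open>The critical pair covers \<open>E\<close>, so every element lies in a cycle and
    its column is nonzero. Equal columns would therefore give a series pair.\<close>
  have f_nz: "f x \<noteq> 0" if x: "x \<in> E" for x
  proof -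
    have "x \<in> C1 \<union> C2" using good[OF C(1-4) x] C(5) by blast
    then obtain K where "K \<in> ?C" "x \<in> K" using min_member_mem[OF C(1)] min_member_mem[OF C(2)] by blast
    then show ?thesis unfolding supports_def by auto
  qed
  have inj: "inj_on f E"
  proof (rule inj_onI, rule ccontr)
    fix x y assume "x \<in> E" "y \<in> E" "f x = f y" "x \<noteq> y"
    then show False using nco[of x y] cocircuit_pair[OF fin dual, of x y] f_nz by blast
  qed
  interpret critical_space E ?C C1 C2
  proof
    fix x y assume xy: "x \<in> E" "y \<in> E" "x \<noteq> y"
    then have "f x \<noteq> f y" using inj by (auto dest: inj_onD)
    then obtain a where "dot n a (f x) = 1 \<longleftrightarrow> dot n a (f y) \<noteq> 1"
      using gf2_eq_iff_dot[of "f x" n "f y"] f_sub xy by blast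
    then have "x \<in> {x\<in>E. dot n a (f x) = 1} \<longleftrightarrow> y \<notin> {x\<in>E. dot n a (f x) = 1}" using xy by simp
    then show "\<exists>C\<in>?C. x \<in> C \<longleftrightarrow> y \<notin> C" using supportsI by (rule bexI)
  qed (use C good in metis)+
  let ?T = "E - {tip}"
  \<comment> \<open>As \<open>?T\<close> is a cycle, some functional is one on all columns except
    that of \<open>tip\<close>: its kernel is the hyperplane sought.\<close>
  obtain a where a: "?T = {x\<in>E. dot n a (f x) = 1}"
    using complement_tip_mem unfolding supports_def by blast
  have T_sub: "f ` ?T \<subseteq> {v \<in> gf2_space n. dot n a v = 1}"
    using a f_sub by blast
  have e: "f tip \<in> gf2_space n - {0}" "dot n a (f tip) = 0"
    using f_sub f_nz tip_in_E a bit_neq_iff by blast+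
  have finT: "finite ?T" and fT: "f ` ?T \<subseteq> gf2_space n" and injT: "inj_on f ?T"
    using fin f_sub inj by (auto intro: inj_on_subset)
  have hc: "hyperplane_complementary (vector_matroid (f ` ?T) (\<lambda>v. v))"
    unfolding hyperplane_complementary_image[OF finT fT injT] supports_diff
    using contract_complementary by blast
  \<comment> \<open>Otherwise a functional vanishing on the other columns would make
    \<open>{tip}\<close> a cycle.\<close>
  have "f tip \<in> gf2.span (f ` ?T)"
  proof (rule ccontr)
    assume "f tip \<notin> gf2.span (f ` ?T)"
    then obtain b where b: "\<And>w. w \<in> f ` ?T \<Longrightarrow> dot n b w = 0" "dot n b (f tip) = 1"
      using separating_functional[of "f tip" n "f ` ?T"] e fT by blast
    have "{x\<in>E. dot n b (f x) = 1} = {tip}"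
    proof (intro equalityI subsetI)
      fix x assume x: "x \<in> {x\<in>E. dot n b (f x) = 1}"
      show "x \<in> {tip}"
      proof (rule ccontr)
        assume "x \<notin> {tip}"
        then have "dot n b (f x) = 0" using b(1)[of "f x"] x by simp
        then show False using x by simp
      qed
    qed (use b tip_in_E in simp)
    then show False using supportsI[of E n b f] tip_not_mem by simp
  qed
  then have "f ` E \<subseteq> gf2.span (f ` ?T)" using gf2.span_base[of _ "f ` ?T"] by blast
  then have spanT: "gf2_space n \<subseteq> gf2.span (f ` ?T)"
    using span gf2.span_minimal[OF _ gf2.subspace_span] by blast
  have n: "n \<ge> 3"
  proof -
    \<comment> \<open>Each of these three columns has a functional that is one there and zero on the
      other two, so they are independent.\<close>
    obtain X where X: "X \<subseteq> E" "card X = 3" "\<And>x. x \<in> X \<Longrightarrow> \<exists>C\<in>?C. C \<inter> X = {x}"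
      using ex_isolated_triple by blast
    have "f x \<notin> gf2.span (f ` X - {f x})" if x: "x \<in> X" for x
    proof
      assume sp: "f x \<in> gf2.span (f ` X - {f x})"
      obtain b where b: "{x\<in>E. dot n b (f x) = 1} \<inter> X = {x}"
        using X(3)[OF x] unfolding supports_def by blast
      have "dot n b (f x) = 0"
      proof (rule dot_eq_0_span[OF sp])
        fix w assume "w \<in> f ` X - {f x}"
        then obtain y where y: "w = f y" "y \<in> X" "y \<noteq> x" by blast
        then have "dot n b (f y) \<noteq> 1" using b X(1) by blast
        then show "dot n b w = 0" using y bit_neq_iff by blast
      qed
      moreover have "dot n b (f x) = 1" using b by blast
      ultimately show False by simp
    qed
    then have "gf2.independent (f ` X)" unfolding gf2.dependent_def by blast
    then have "card (f ` X) \<le> n" using card_independent_le[of "f ` X" n] X(1) f_sub by blast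
    then show ?thesis using X(2) card_image[OF inj_on_subset[OF inj X(1)]] by simp
  qed
  have "insert (f tip) (f ` ?T) = f ` E"
    using tip_in_E by (simp only: image_insert[symmetric] insert_Diff)
  then have "vector_matroid (f ` E) (\<lambda>v. v) \<in> AG_plus_family"
    unfolding AG_plus_family_iff using e T_sub hc spanT n
    by (intro exI[of _ n] exI[of _ a] exI[of _ "f tip"] exI[of _ "f ` ?T"]) simp
  moreover have "isomorphic (dual M) (vector_matroid (f ` E) (\<lambda>v. v))"
    unfolding dual by (rule isomorphic_vector_matroid[OF inj])
  ultimately show ?thesis by blast
qed

lemma family_imp_excluded_series_minor:
  fixes M :: "'a matroid"
  assumes M: "matroid M" and bin: "binary M"
    and N: "N \<in> AG_plus_family" "isomorphic (dual M) N"
  shows "excluded_series_minor circuit_difference M"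
proof -
  define E where "E = ground M"
  have fin: "finite E" using M by (simp add: matroid_def E_def)
  obtain n a e S where e: "e \<in> gf2_space n - {0}" "dot n a e = 0"
    and S: "S \<subseteq> {v \<in> gf2_space n. dot n a v = 1}"
    and hc: "hyperplane_complementary (vector_matroid S (\<lambda>v. v))"
    and span: "gf2_space n \<subseteq> gf2.span S" and n: "n \<ge> 3"
    and N_eq: "N = vector_matroid (insert e S) (\<lambda>v. v)"
    using N(1) unfolding AG_plus_family_iff by blast
  have "I \<subseteq> ground (dual M)" if "I \<in> indep (dual M)" for I
    using that unfolding indep_dual by auto
  then obtain f where f: "bij_betw f E (insert e S)" and dual: "dual M = vector_matroid E f"
    using isomorphic_vector_matroidE[OF N(2)[unfolded N_eq]] unfolding ground_dual E_def by metis
  have inj: "inj_on f E" and fE: "f ` E = insert e S" using f unfolding bij_betw_def by blast+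
  have "e \<in> f ` E" by (simp add: fE)
  then obtain t where t: "t \<in> E" "f t = e" by blast
  have eS: "e \<notin> S" using S e by auto
  let ?T = "E - {t}"
  have fT: "f ` ?T = S"
    using inj_on_image_set_diff[OF inj, of E "{t}"] t fE eS by auto
  have f_sub: "f ` E \<subseteq> gf2_space n" unfolding fE using S e by blast
  let ?C = "supports n E f"
  interpret cycle_space E ?C using fin by (rule cycle_space_supports)
  have "M = dual (vector_matroid E f)" using matroid.dual_dual[OF M] dual by simp
  then have M_eq: "M = cycle_matroid E ?C" using dual_vector_matroid[OF f_sub] by simp
  have circ: "circuit M C \<longleftrightarrow> min_member ?C C" for C
    unfolding M_eq by (rule circuit_cycle_matroid[OF sub_E])
  have finT: "finite ?T" and fT_sub: "f ` ?T \<subseteq> gf2_space n" and injT: "inj_on f ?T"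
    using fin f_sub inj by (auto intro: inj_on_subset)
  have comp: "min_member ((\<lambda>C. C - {t}) ` ?C) (?T - K)"
    if "min_member ((\<lambda>C. C - {t}) ` ?C) K" for K
    using hyperplane_complementary_image[OF finT fT_sub injT] hc that
    unfolding fT supports_diff by blast
  have f_in_S: "f x \<in> S" if "x \<in> ?T" for x
    using imageI[OF that, of f] unfolding fT .
  have "{x\<in>E. dot n a (f x) = 1} = ?T"
  proof (intro equalityI subsetI)
    fix x assume "x \<in> ?T"
    then show "x \<in> {x\<in>E. dot n a (f x) = 1}" using f_in_S S by blast
  qed (use t e in auto)
  then have T_mem: "?T \<in> ?C" using supportsI[of E n a f] by simp
  \<comment> \<open>The columns from \<open>?T\<close> form \<open>S\<close>, which spans; a
    functional vanishing on them is zero.\<close>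
  have supp_zero: "dot n b v = 0" if "\<And>x. x \<in> ?T \<Longrightarrow> dot n b (f x) = 0" "v \<in> gf2_space n" for b v
  proof (rule dot_eq_0_span)
    show "v \<in> gf2.span S" using span that by blast
    fix w assume "w \<in> S"
    then have "w \<in> f ` ?T" unfolding fT .
    then show "dot n b w = 0" using that(1) by blast
  qed
  have t_not_mem: "{t} \<notin> ?C"
  proof
    assume "{t} \<in> ?C"
    then obtain b where b: "{t} = {x\<in>E. dot n b (f x) = 1}" unfolding supports_def by blast
    have "dot n b e = 0"
    proof (rule supp_zero)
      fix x assume "x \<in> ?T"
      then have "dot n b (f x) \<noteq> 1" using b by blast
      then show "dot n b (f x) = 0" using bit_neq_iff by blast
    qed (use e in blast)
    moreover have "dot n b e = 1" using b t by blast
    ultimately show False by simp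
  qed
  have mm: "min_member ?C D" if "D \<in> ?C" "D \<noteq> {}" "D \<noteq> ?T" for D
    using min_member_if_contract_complementary[OF comp T_mem t_not_mem t(1) that] .
  \<comment> \<open>A nonzero functional vanishing at \<open>e\<close> and at one more column has a
    nonempty support properly inside \<open>?T\<close>. Hence \<open>?T\<close> is not a
    circuit.\<close>
  obtain D where D: "D \<in> ?C" "D \<subseteq> ?T" "D \<noteq> {}" "D \<noteq> ?T"
  proof -
    have "\<not> gf2_space n \<subseteq> {0}"
    proof
      assume "gf2_space n \<subseteq> {0}"
      then show False using e by blast
    qed
    then have "S \<noteq> {}" using span by auto
    then have "?T \<noteq> {}" using fT by auto
    then obtain x where x: "x \<in> ?T" by blast
    obtain b u where b: "dot n b e = 0" "dot n b (f x) = 0" "u \<in> gf2_space n" "dot n b u = 1"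
      by (rule ex_functional_separating[OF n, of e "f x"]) (use e f_sub x in blast)+
    let ?D = "{x\<in>E. dot n b (f x) = 1}"
    have "t \<notin> ?D" "x \<notin> ?D" using b t by simp_all
    moreover have "?D \<noteq> {}"
    proof
      assume D0: "?D = {}"
      have "dot n b u = 0"
      proof (rule supp_zero)
        fix y assume "y \<in> ?T"
        then have "dot n b (f y) \<noteq> 1" using D0 by blast
        then show "dot n b (f y) = 0" using bit_neq_iff by blast
      qed (rule b(3))
      then show False using b(4) by simp
    qed
    ultimately show thesis using that[of ?D] supportsI[of E n b f] x by blast
  qed
  have T_not_mm: "\<not> min_member ?C ?T"
    using min_memberD[of ?C ?T D] D by blast
  have ncd: "\<not> circuit_difference M"
  proof
    assume cd: "circuit_difference M"
    have "e \<noteq> 0" "e \<in> gf2_space n" using e by blast+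
    \<comment> \<open>The failing pair: the support \<open>?K\<close> of a functional that is one at
      \<open>e\<close>, and its sum with \<open>?T\<close>. Both are circuits through
      \<open>t\<close>, and their symmetric difference is \<open>?T\<close>.\<close>
    then obtain b where b: "dot n b e = 1"
      using gf2_eq_iff_dot[of e n 0] by (auto simp: gf2_space_def)
    let ?K = "{x\<in>E. dot n b (f x) = 1}"
    have K: "?K \<in> ?C" "t \<in> ?K" using supportsI[of E n b f] t b by simp_all
    have KT: "sym_diff ?K ?T \<in> ?C" using sym_diff_mem[OF K(1) T_mem] .
    have tKT: "t \<in> sym_diff ?K ?T" using K(2) by blast
    have "?T \<noteq> {}" using D by blast
    have 1: "min_member ?C ?K" by (rule mm[OF K(1)]) (use K(2) in blast)+
    have 2: "min_member ?C (sym_diff ?K ?T)" by (rule mm[OF KT]) (use tKT in blast)+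
    have "sym_diff ?K ?T \<noteq> ?K" using \<open>?T \<noteq> {}\<close> by blast
    then have "min_member ?C (sym_diff ?K (sym_diff ?K ?T))"
      using cd 1 2 K(2) tKT unfolding circuit_difference_def circ by blast
    moreover have "sym_diff ?K (sym_diff ?K ?T) = ?T" by blast
    ultimately show False using T_not_mm by simp
  qed
  have del: "circuit_difference (delete M {x})" if x: "x \<in> E" for x
    unfolding circuit_difference_def circuit_delete circ
  proof (intro allI impI)
    fix C1 C2
    assume C: "min_member ?C C1 \<and> C1 \<inter> {x} = {}" "min_member ?C C2 \<and> C2 \<inter> {x} = {}"
      "C1 \<noteq> C2" "C1 \<inter> C2 \<noteq> {}"
    have "sym_diff C1 C2 \<in> ?C"
      using sym_diff_mem[OF min_member_mem min_member_mem] C by blast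
    moreover have "sym_diff C1 C2 \<noteq> {}" using C by blast
    \<comment> \<open>If \<open>?T\<close> were the symmetric difference, the deleted
      \<open>x\<close> would have to be \<open>t\<close>. Then both circuits lie inside
      \<open>?T\<close>, and a common element would be missing from their symmetric
      difference.\<close>
    moreover have "sym_diff C1 C2 \<noteq> ?T"
    proof
      assume T: "sym_diff C1 C2 = ?T"
      then have "x = t" using C x by blast
      then have "C1 \<subseteq> ?T" using C min_member_sub[of C1] by blast
      then show False using T C by blast
    qed
    ultimately have "min_member ?C (sym_diff C1 C2)" by (rule mm)
    then show "min_member ?C (sym_diff C1 C2) \<and> sym_diff C1 C2 \<inter> {x} = {}" using C by blast
  qed
  have "\<not> cocircuit M {x, y}" if "x \<noteq> y" for x y
    using cocircuit_pair[OF fin dual that] inj that by (auto dest: inj_onD)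
  then show ?thesis
    unfolding excluded_series_minor_iff[OF M bin] using ncd del by (simp add: E_def)
qed

theorem theorem4p4:
  fixes M :: "'a matroid"
  assumes "matroid M" and "binary M"
  shows "excluded_series_minor circuit_difference M \<longleftrightarrow>
    (\<exists>N\<in>AG_plus_family. isomorphic (dual M) N)"
  using excluded_series_minor_imp_family[OF assms] family_imp_excluded_series_minor[OF assms]
  by blast

end
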